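(* Let $(a,b)\in\mathcal P$ with $-1\le a<0<b\le1$ and $a\le-b$, and let $m\ge1$ be an integer. If $1\le-\frac1a\le b+1$ and $a\le-\frac1b+m\le a+1$, then $$\mu_{a,b}=\frac{1}{K_{a,b}}h_{a,b}(x)\,dx,$$ where $K_{a,b}=\log[(m-a)(1+b)^{2-m}]$ and $h_{a,b}(x)=h^+_{a,b}(x)+h^-_{a,b}(x)$ for $x\in[a,b)$, with $$h^+_{a,b}(x)=\begin{cases}\dfrac{1}{x+\frac{p+1}{p}} & \text{if } (T^{-2}S)^{p-1}(b-1)\le x<(T^{-2}S)^{p}(b-1),\ p=1,\dots,m-1,\\[2mm] \dfrac{1}{x+\frac{m+1}{m}} & \text{if } (T^{-2}S)^{m-1}(b-1)\le x<-\frac1a-1,\\[2mm] \dfrac{1}{x+1} & \text{if } -\frac1a-1\le x<b,\end{cases}$$ and $$h^-_{a,b}(x)=\begin{cases}\dfrac{1}{m-x} & \text{if } a\le x<-\frac1b+m,\\[2mm] \dfrac{1}{m+1-x} & \text{if } -\frac1b+m\le x<a+1,\end{cases}$$ where $h^+_{a,b}(x)=0$ for $x\in[a,b-1)$ and $h^-_{a,b}(x)=0$ for $x\in[a+1,b)$.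
   Context: Notation: $\bar{\mathbb R}=\mathbb R\cup\{\infty\}$, $T(x)=x+1$, $S(x)=-1/x$, so $T^{-2}S(x)=-\frac1x-2$; $\mathcal P=\{(a,b): a\le 0\le b,\ b-a\ge 1,\ -ab\le 1\}$. Let $\Delta=\{(x,y)\in\bar{\mathbb R}^2: x=y\}$ and let $F_{a,b}:\bar{\mathbb R}^2\setminus\Delta\to\bar{\mathbb R}^2\setminus\Delta$ be $F_{a,b}(x,y)=(x+1,y+1)$ if $y<a$; $(-1/x,-1/y)$ if $a\le y<b$; $(x-1,y-1)$ if $y\ge b$. Let $D_{a,b}=\bigcap_{n\ge0}F_{a,b}^n(\bar{\mathbb R}^2\setminus\Delta)$ be its attractor. Put $\lfloor x\rceil_{a,b}=\lfloor x-a\rfloor$ if $x<a$, $0$ if $a\le x<b$, and $\lceil x-b\rceil$ if $x\ge b$, where $\lceil t\rceil:=\lfloor t\rfloor+1$. The Gauss-type map is $\hat f_{a,b}:[a,b)\to[a,b)$, $\hat f_{a,b}(x)=-\frac1x-\lfloor-\frac1x\rceil_{a,b}$, $\hat f_{a,b}(0)=0$. Let $\Lambda_{a,b}=S(D_{a,b}\cap\{(u,w):a\le w\le b\})$ (with $S$ acting on both coordinates), and let $\hat\Lambda_{a,b}$ be its image under the change of coordinates $x=-1/w$, $y=u$. The natural extension map is $\hat F_{a,b}(x,y)=\Bigl(\hat f_{a,b}(x),-\frac{1}{y-\lfloor-1/x\rceil_{a,b}}\Bigr)$ on $\hat\Lambda_{a,b}$; it preserves $d\nu=\frac{dx\,dy}{(1+xy)^2}$.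 Put $K_{a,b}=\nu(\hat\Lambda_{a,b})$ and $d\nu_{a,b}=\frac{dx\,dy}{K_{a,b}(1+xy)^2}$, an $\hat F_{a,b}$-invariant probability measure. Then $\mu_{a,b}$ denotes the push-forward of $\nu_{a,b}$ to the $x$-coordinate, an $\hat f_{a,b}$-invariant probability measure on $[a,b)$.
   Formalization: The attractor D_{a,b} is taken as the union, over compact C in R̄²∖Δ, of the points lying in F^k(C) for infinitely many k; the printed ⋂F^n(R̄²∖Δ) is all of R̄²∖Δ for these parameters, which would make K_{a,b} infinite. *)

theory Defs
  imports "HOL-Analysis.Analysis"
begin

text \<open>
  The extended line is the real line with one point at infinity, so \<^typ>\<open>ereal\<close> does not fit;
  \<^const>\<open>None\<close> is the point at infinity (as in \<^const>\<open>Alexandroff_compactification\<close>).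
\<close>

type_synonym rbar = "real option"

text \<open>The order on the extended line has infinity as its greatest element.\<close>

fun rbar_less :: "rbar \<Rightarrow> real \<Rightarrow> bool" where
  "rbar_less None c = False"
| "rbar_less (Some r) c = (r < c)"

definition shift :: "real \<Rightarrow> rbar \<Rightarrow> rbar" where
  "shift t = map_option (\<lambda>r. r + t)"

text \<open>The map \<open>x \<mapsto> -1/x\<close>, exchanging 0 and infinity.\<close>

fun S :: "rbar \<Rightarrow> rbar" where
  "S None = Some 0"
| "S (Some r) = (if r = 0 then None else Some (- 1 / r))"

definition param_set :: "(real \<times> real) set" where
  "param_set = {(a, b). a \<le> 0 \<and> 0 \<le> b \<and> b - a \<ge> 1 \<and> - a * b \<le> 1}"

definition F :: "real \<Rightarrow> real \<Rightarrow> rbar \<times> rbar \<Rightarrow> rbar \<times> rbar" where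
  "F a b = (\<lambda>(x, y).
     if rbar_less y a then (shift 1 x, shift 1 y)
     else if rbar_less y b then (S x, S y)
     else (shift (- 1) x, shift (- 1) y))"

definition rbar_top :: "rbar topology" where
  "rbar_top = Alexandroff_compactification euclideanreal"

definition offdiag :: "(rbar \<times> rbar) set" where
  "offdiag = {(x, y). x \<noteq> y}"

text \<open>
  The attractor consists of the points lying in \<open>F\<^sup>k(C)\<close> for infinitely many \<open>k\<close>, for some compact
  set \<open>C\<close> of initial points off the diagonal.  With the whole noncompact space in place of \<open>C\<close> the
  formula would be \<open>\<Inter>n. F\<^sup>n(offdiag)\<close>, because these images decrease.  That intersection is
  not an attractor: by the next lemma it is all of \<open>offdiag\<close> whenever \<open>b \<le> a + 2\<close>, since every point
  has preimages \<open>(x \<mp> n, y \<mp> n)\<close> of all orders \<open>n\<close>, escaping to the removed point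
  \<open>(\<infinity>, \<infinity>)\<close> of the diagonal; the resulting set would have infinite invariant measure.
\<close>

definition attractor :: "real \<Rightarrow> real \<Rightarrow> (rbar \<times> rbar) set" where
  "attractor a b =
     (\<Union>C \<in> {C. compactin (prod_topology rbar_top rbar_top) C \<and> C \<subseteq> offdiag}.
        \<Inter>n::nat. \<Union>k\<in>{n..}. (F a b ^^ k) ` C)"

lemma Inter_images_offdiag:
  assumes "a \<le> b" "b \<le> a + 2"
  shows "(\<Inter>n::nat. (F a b ^^ n) ` offdiag) = offdiag"
proof -
  have shift_inj: "shift t x = shift t y \<longleftrightarrow> x = y" for t x y
    by (cases x; cases y) (auto simp: shift_def)
  have S_inj: "S x = S y \<longleftrightarrow> x = y" for x y
    by (cases x; cases y) auto
  have shift_shift: "shift t (shift (- t) x) = x" "shift (- t) (shift t x) = x" for t x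
    by (cases x; simp add: shift_def)+
  have sub: "F a b z \<in> offdiag" if "z \<in> offdiag" for z
    using that by (auto simp: F_def offdiag_def shift_inj S_inj split: if_splits)
  have sup: "z \<in> F a b ` offdiag" if z: "z \<in> offdiag" for z
  proof -
    obtain x y where [simp]: "z = (x, y)" by (cases z)
    show ?thesis
    proof (cases "rbar_less y (a + 1)")
      case True
      then have "rbar_less (shift (- 1) y) a"
        by (cases y) (auto simp: shift_def)
      then have "F a b (shift (- 1) x, shift (- 1) y) = z"
        by (simp add: F_def shift_shift)
      moreover have "(shift (- 1) x, shift (- 1) y) \<in> offdiag"
        using z by (simp add: offdiag_def shift_inj)
      ultimately show ?thesis by (metis image_eqI)
    next
      case False
      then have "\<not> rbar_less (shift 1 y) b" "\<not> rbar_less (shift 1 y) a"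
        using assms by (cases y; auto simp: shift_def)+
      then have "F a b (shift 1 x, shift 1 y) = z"
        by (simp add: F_def shift_shift)
      moreover have "(shift 1 x, shift 1 y) \<in> offdiag"
        using z by (simp add: offdiag_def shift_inj)
      ultimately show ?thesis by (metis image_eqI)
    qed
  qed
  have im: "F a b ` offdiag = offdiag"
    using sub sup by blast
  have "(F a b ^^ n) ` offdiag = offdiag" for n
  proof (induction n)
    case (Suc n)
    have "(F a b ^^ Suc n) ` offdiag = F a b ` ((F a b ^^ n) ` offdiag)"
      by (simp add: image_comp)
    then show ?case using Suc im by simp
  qed simp
  then show ?thesis by simp
qed

definition Lam :: "real \<Rightarrow> real \<Rightarrow> (rbar \<times> rbar) set" where
  "Lam a b = map_prod S S ` (attractor a b \<inter> {(u, w). \<exists>r. w = Some r \<and> a \<le> r \<and> r \<le> b})"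

definition Lam_hat :: "real \<Rightarrow> real \<Rightarrow> (rbar \<times> rbar) set" where
  "Lam_hat a b = (\<lambda>(u, w). (S w, u)) ` Lam a b"

text \<open>
  The part of \<^const>\<open>Lam_hat\<close> in the finite plane; points with a coordinate at infinity
  are irrelevant for \<open>dx dy / (1 + x y)\<^sup>2\<close>.
\<close>

definition Lam_hat_real :: "real \<Rightarrow> real \<Rightarrow> (real \<times> real) set" where
  "Lam_hat_real a b = {(x, y). (Some x, Some y) \<in> Lam_hat a b}"

definition nu :: "(real \<times> real) measure" where
  "nu = density lebesgue (\<lambda>(x, y). ennreal (1 / (1 + x * y)\<^sup>2))"

definition K :: "real \<Rightarrow> real \<Rightarrow> real" where
  "K a b = measure nu (Lam_hat_real a b)"

text \<open>
  The normalised measure, regarded as a measure on the whole plane carried by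
  \<^const>\<open>Lam_hat_real\<close>; correspondingly \<open>mu a b\<close> below is a Borel measure on the line.
\<close>

definition nu_ab :: "real \<Rightarrow> real \<Rightarrow> (real \<times> real) measure" where
  "nu_ab a b = density lebesgue
     (\<lambda>(x, y). indicator (Lam_hat_real a b) (x, y) * ennreal (1 / (K a b * (1 + x * y)\<^sup>2)))"

definition mu :: "real \<Rightarrow> real \<Rightarrow> real measure" where
  "mu a b = distr (nu_ab a b) borel fst"

text \<open>The map \<open>T\<^sup>-\<^sup>2 S\<close> on finite points.\<close>

definition T2S :: "real \<Rightarrow> real" where
  "T2S x = - 1 / x - 2"

text \<open>
  The case distinctions are written as sums over pairwise disjoint half-open intervals, so that
  the values are 0 where no case applies.
\<close>

definition h_plus :: "real \<Rightarrow> real \<Rightarrow> nat \<Rightarrow> real \<Rightarrow> real" where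
  "h_plus a b m x =
     (\<Sum>p = 1..m - 1. if (T2S ^^ (p - 1)) (b - 1) \<le> x \<and> x < (T2S ^^ p) (b - 1)
                       then 1 / (x + (real p + 1) / real p) else 0)
     + (if (T2S ^^ (m - 1)) (b - 1) \<le> x \<and> x < - 1 / a - 1
        then 1 / (x + (real m + 1) / real m) else 0)
     + (if - 1 / a - 1 \<le> x \<and> x < b then 1 / (x + 1) else 0)"

definition h_minus :: "real \<Rightarrow> real \<Rightarrow> nat \<Rightarrow> real \<Rightarrow> real" where
  "h_minus a b m x =
     (if a \<le> x \<and> x < - 1 / b + real m then 1 / (real m - x)
      else if - 1 / b + real m \<le> x \<and> x < a + 1 then 1 / (real m + 1 - x)
      else 0)"

definition h :: "real \<Rightarrow> real \<Rightarrow> nat \<Rightarrow> real \<Rightarrow> real" where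
  "h a b m x = h_plus a b m x + h_minus a b m x"

end

theory Submission
  imports Defs
begin

text \<open>
  In the coordinates \<open>x = w\<close>, \<open>y = - 1 / u\<close> on the strip \<open>a \<le> w < b\<close>, the first return of \<open>F a b\<close> to the
  strip is \<open>(x, y) \<mapsto> (- 1 / x - n, - 1 / (y - n))\<close>.  An explicit finite union \<open>Dom\<close> of rectangles is
  mapped into itself, and every point of \<open>Dom\<close> with irrational \<open>y\<close> has a preimage in \<open>Dom\<close> with
  irrational \<open>y\<close>; as \<open>Dom\<close> lies in a compact set off the diagonal, such points are in the attractor.
  Conversely, orbits starting in a compact set off the diagonal enter \<open>Dom\<close> after a uniformly bounded
  number of steps: outside \<open>Dom\<close> the distance \<open>\<bar>u - w\<bar>\<close> is expanded, but cannot exceed 1 as long as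
  \<open>u\<close> and \<open>w\<close> are of equal sign, \<open>\<bar>u\<bar> < 1\<close> and \<open>\<bar>w\<bar> \<le> 1\<close>, and otherwise \<open>Dom\<close> is entered soon.  Hence
  \<open>Lam_hat_real\<close> is \<open>Dom\<close> up to a null set.  Integrating \<open>1 / (1 + x y)\<^sup>2\<close> over the vertical slices of
  \<open>Dom\<close> gives \<open>h\<close>; in the integral of \<open>h\<close> the logarithms telescope.
\<close>

section \<open>Preliminaries\<close>

text \<open>The attractor counts applications of \<open>F\<close>, so trapping times must be bounded
  in that count, although one return to the strip can take arbitrarily many translations. A run of
  translations that is long compared with \<open>y\<close> ends in \<open>Dom\<close> at once, and
  the positions before that return are off the strip and do not count. Otherwise \<open>y\<close> is
  itself large, and the separation from the diagonal bounds the run. A return multiplies the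
  distance \<open>\<bar>r - x\<bar>\<close> by \<open>1 / \<bar>r * x\<bar>\<close>, which can be
  arbitrarily close to 1, so the distance alone gives no uniform bound on the number of returns.
  Dividing its square by \<open>\<bar>x\<bar>\<close> brings in the product
  \<open>\<bar>x\<bar> * \<bar>x'\<bar>\<close> of consecutive positions, and this product is at
  most \<open>1 / (1 + b / 2)\<close>. Preimages are chosen by the fractional part of
  \<open>1 / y'\<close>. Irrational \<open>y'\<close> keeps it away from 0, and irrationality passes
  to the preimage, so the choice can be repeated for ever; the price is a null set.\<close>

lemma half_le: "1 \<le> p \<Longrightarrow> 1 / 2 \<le> real p / (real p + 1)"
  by (simp add: field_simps)

text \<open>As long as \<open>r\<close> and \<open>x\<close> keep a common sign and \<open>\<bar>r\<bar> < 1\<close>, the quantity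
  \<open>(r - x)\<^sup>2 / \<bar>x\<bar>\<close> grows geometrically, but it cannot exceed 1.\<close>

lemma separation_grows:
  fixes q :: real
  assumes "x \<noteq> 0" "r \<noteq> 0" "\<bar>r\<bar> < 1" "\<bar>x\<bar> \<le> 1" "\<bar>r'\<bar> < 1" "\<bar>x'\<bar> \<le> 1" "0 < r' * x'"
    and eq: "r' - x' = - 1 / r + 1 / x" and q: "0 < q" "q * (\<bar>x\<bar> * \<bar>x'\<bar>) \<le> 1"
  shows "(r - x)\<^sup>2 \<le> \<bar>x\<bar>" "\<bar>r - x\<bar> \<le> \<bar>r' - x'\<bar>"
    and "\<bar>x\<bar> < (r - x)\<^sup>2 * (q * c) \<Longrightarrow> \<bar>x'\<bar> < (r' - x')\<^sup>2 * c"
proof -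
  have d: "r' - x' = (r - x) / (r * x)" using eq assms(1,2) by (simp add: field_simps)
  have rx: "0 < \<bar>r * x\<bar>" "\<bar>r * x\<bar> \<le> 1" using assms by (auto simp: abs_mult mult_le_one)
  show "\<bar>r - x\<bar> \<le> \<bar>r' - x'\<bar>"
    using rx mult_left_mono[of "\<bar>r * x\<bar>" 1 "\<bar>r - x\<bar>"] by (simp add: d abs_divide field_simps)
  \<comment> \<open>Two numbers of one sign and of modulus at most 1 differ by at most 1. This turns
    the expansion into an upper bound for \<open>\<bar>r - x\<bar>\<close>.\<close>
  have "\<bar>r' - x'\<bar> \<le> 1" using assms(5-7) by (auto simp: zero_less_mult_iff)
  then have le: "\<bar>r - x\<bar> \<le> \<bar>r * x\<bar>" using rx by (simp add: d abs_divide field_simps)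
  have "(r - x)\<^sup>2 \<le> (r * x)\<^sup>2" using le by (simp add: abs_le_square_iff)
  also have "\<dots> = \<bar>x\<bar> * (r\<^sup>2 * \<bar>x\<bar>)" by (simp add: power2_eq_square power_mult_distrib mult_ac abs_mult_self_eq)
  also have "\<dots> \<le> \<bar>x\<bar> * 1" using assms by (intro mult_left_mono mult_le_one) (auto simp: abs_square_le_1)
  finally show "(r - x)\<^sup>2 \<le> \<bar>x\<bar>" by simp
  \<comment> \<open>Growth of the ratio by the factor \<open>q\<close>, put without division:
    \<open>c\<close> is the inverse of a threshold, and iterating the claim uses up a power of
    \<open>q\<close>.\<close>
  assume lt: "\<bar>x\<bar> < (r - x)\<^sup>2 * (q * c)"
  have r2: "0 < r\<^sup>2" "r\<^sup>2 \<le> 1" using assms by (auto simp: abs_square_le_1)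
  have "\<bar>x'\<bar> * (q * (r\<^sup>2 * x\<^sup>2)) = (q * (\<bar>x\<bar> * \<bar>x'\<bar>)) * (r\<^sup>2 * \<bar>x\<bar>)"
    by (simp add: power2_eq_square mult_ac)
  also have "\<dots> \<le> 1 * (1 * \<bar>x\<bar>)" using q r2 by (intro mult_mono) auto
  also have "\<dots> < (r - x)\<^sup>2 * (q * c)" using lt by simp
  finally have "q * (\<bar>x'\<bar> * (r * x)\<^sup>2) < q * ((r - x)\<^sup>2 * c)" by (simp add: mult_ac power_mult_distrib)
  then have "\<bar>x'\<bar> * (r * x)\<^sup>2 < (r - x)\<^sup>2 * c" using q by simp
  then show "\<bar>x'\<bar> < (r' - x')\<^sup>2 * c" using rx by (simp add: d power_divide field_simps)
qed

text \<open>Applied with \<open>X = \<bar>x\<bar>\<close>, \<open>Y = 1 / \<bar>r\<bar>\<close>, a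
  lower bound \<open>d\<close> for \<open>\<bar>r - x\<bar>\<close>, and \<open>c\<close> a number
  of translations less a constant. If \<open>X * Y \<le> 1\<close>, then
  \<open>Y \<le> 1 / d\<close> and \<open>c\<close> lies below \<open>Y\<close>; otherwise
  \<open>X\<close> is at least \<open>d\<close> and \<open>c \<le> 1 / X\<close>.\<close>

lemma separated_bound:
  fixes X Y d c :: real
  assumes "0 < d" "0 < X" "0 < Y" "d * Y \<le> \<bar>1 - X * Y\<bar>" "X * c \<le> 1" "c < Y"
  shows "c \<le> 1 / d"
proof (cases "1 - X * Y \<ge> 0")
  case True
  then have "d * Y \<le> 1" using assms mult_pos_pos[OF assms(2,3)] by linarith
  then have "Y \<le> 1 / d" using assms by (simp add: field_simps)
  then show ?thesis using assms by simp
next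
  case False
  then have "d * Y \<le> X * Y" using assms by linarith
  then have "d \<le> X" using assms by simp
  then show ?thesis
  proof (cases "0 \<le> c")
    case True
    then have "d * c \<le> 1" using \<open>d \<le> X\<close> assms mult_right_mono[of d X c] by linarith
    then show ?thesis using assms by (simp add: field_simps)
  next
    case False
    then show ?thesis using assms by (smt (verit) divide_pos_pos)
  qed
qed

lemma compl_frac_le: "0 < q \<Longrightarrow> 1 / q \<le> f \<longleftrightarrow> 1 - f \<le> (q - 1) / (q :: real)"
  by (simp add: field_simps)

text \<open>The left side is a branch of \<open>h_plus\<close>; the right side is the antiderivative
  \<open>y / (1 + x * y)\<close> at the height \<open>y = q / (q + 1)\<close>.\<close>

lemma frac_inverse: "0 < q \<Longrightarrow> 1 / (x + (q + 1) / q) = (q / (q + 1)) / (1 + x * (q / (q + 1)))" for q x :: real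
proof -
  assume q: "0 < q"
  then have "(q + 1) / q * (q / (q + 1)) = 1" by simp
  then have e: "1 + x * (q / (q + 1)) = (x + (q + 1) / q) * (q / (q + 1))"
    unfolding distrib_right by simp
  show ?thesis unfolding e using q by simp
qed

lemma ln_ratio_nonneg: "0 < v \<Longrightarrow> v \<le> u \<Longrightarrow> 0 \<le> ln (u / v :: real)"
  by (intro ln_ge_zero) simp

lemma shift_shift: "shift s (shift r u) = shift (r + s) u"
  by (cases u) (auto simp: shift_def)

lemma S_S: "S (S u) = u"
  by (cases u) auto

section \<open>Topology of the extended line\<close>

abbreviation plane :: "(rbar \<times> rbar) topology" where
  "plane \<equiv> prod_topology rbar_top rbar_top"

lemma openin_rbar_finite: "open U \<Longrightarrow> openin rbar_top (Some ` U)"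
  by (auto simp: rbar_top_def openin_Alexandroff_compactification)

lemma openin_rbar_infinite:
  assumes "compact (- U)" shows "openin rbar_top (insert None (Some ` U))"
  unfolding rbar_top_def openin_Alexandroff_compactification
  using assms compact_imp_closed[OF assms] by (intro disjI2 exI[of _ "- U"]) auto

lemma topspace_rbar: "topspace rbar_top = UNIV"
  by (simp add: rbar_top_def flip: UNIV_option_conv)

lemma compactin_rbar_closedin: "closedin rbar_top A \<Longrightarrow> compactin rbar_top A"
  unfolding rbar_top_def by (intro closedin_compact_space compact_space_Alexandroff_compactification)

lemma compactin_rbar_infinite:
  assumes "closed A" shows "compactin rbar_top (insert None (Some ` A))"
proof (rule compactin_rbar_closedin)
  have "UNIV - insert None (Some ` A) = Some ` (- A)"
    by (rule set_eqI, case_tac x) auto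
  then show "closedin rbar_top (insert None (Some ` A))"
    using openin_rbar_finite[OF open_Compl[OF assms]]
    by (simp only: closedin_def topspace_rbar subset_UNIV simp_thms)
qed

lemma compactin_rbar_finite:
  assumes "compact A" shows "compactin rbar_top (Some ` A)"
proof (rule compactin_rbar_closedin)
  have "UNIV - Some ` A = insert None (Some ` (- A))"
    by (rule set_eqI, case_tac x) auto
  then show "closedin rbar_top (Some ` A)"
    using assms openin_rbar_infinite[of "- A"]
    by (simp only: closedin_def topspace_rbar subset_UNIV simp_thms double_compl)
qed

lemma compact_abs_le: "compact (- {r :: real. M < \<bar>r\<bar>})"
proof -
  have "- {r :: real. M < \<bar>r\<bar>} = {- M..M}" by auto
  then show ?thesis by (simp only: compact_Icc)
qed

text \<open>The antiderivative \<open>y / (1 + x * y)\<close> is regular at \<open>x = 0\<close>,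
  unlike \<open>- 1 / (x * (1 + x * y))\<close>. Positivity of \<open>1 + x * y\<close> at the two
  ends extends to the interval because the expression is affine in \<open>y\<close>.\<close>

lemma nn_integral_slice:
  fixes x :: real
  assumes "l \<le> u" "0 < 1 + x * l" "0 < 1 + x * u" "0 \<le> c"
  shows "(\<integral>\<^sup>+y. ennreal (c / (1 + x * y)\<^sup>2) * indicator {l..u} y \<partial>lborel)
    = ennreal (c * (u / (1 + x * u) - l / (1 + x * l)))"
proof -
  have pos: "0 < 1 + x * y" if "y \<in> {l..u}" for y
  proof (cases "0 \<le> x")
    case True
    then have "x * l \<le> x * y" using that by (intro mult_left_mono) auto
    then show ?thesis using assms(2) by linarith
  next
    case False
    then have "x * u \<le> x * y" using that by (intro mult_left_mono_neg) auto
    then show ?thesis using assms(3) by linarith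
  qed
  have "(\<integral>\<^sup>+y. ennreal (c / (1 + x * y)\<^sup>2) * indicator {l..u} y \<partial>lborel)
    = ennreal (c * (u / (1 + x * u)) - c * (l / (1 + x * l)))"
  proof (rule nn_integral_FTC_Icc[where F = "\<lambda>y. c * (y / (1 + x * y))"])
    show "DERIV (\<lambda>y. c * (y / (1 + x * y))) y :> c / (1 + x * y)\<^sup>2" if "y \<in> {l..u}" for y
      using pos[OF that] by (auto intro!: derivative_eq_intros simp: power2_eq_square field_simps)
  qed (use assms in auto)
  then show ?thesis by (simp add: algebra_simps)
qed

lemma nn_integral_ln_plus:
  fixes l r c :: real
  assumes "l \<le> r" "0 < l + c"
  shows "(\<integral>\<^sup>+x. ennreal (if l \<le> x \<and> x < r then 1 / (x + c) else 0) \<partial>lborel) = ennreal (ln ((r + c) / (l + c)))"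
proof -
  have "(\<integral>\<^sup>+x. ennreal (if l \<le> x \<and> x < r then 1 / (x + c) else 0) \<partial>lborel)
    = (\<integral>\<^sup>+x. ennreal (1 / (x + c)) * indicator {l..r} x \<partial>lborel)"
    using AE_lborel_singleton[of r] by (intro nn_integral_cong_AE) (auto split: split_indicator)
  also have "\<dots> = ennreal (ln (r + c) - ln (l + c))"
  proof (rule nn_integral_FTC_Icc[where F = "\<lambda>x. ln (x + c)"])
    show "DERIV (\<lambda>x. ln (x + c)) x :> 1 / (x + c)" if "x \<in> {l..r}" for x
      using assms that
      by (auto intro!: derivative_eq_intros)
  qed (use assms in auto)
  finally show ?thesis using assms by (simp add: ln_div)
qed

lemma nn_integral_ln_minus:
  fixes l r d :: real
  assumes "l \<le> r" "r < d"
  shows "(\<integral>\<^sup>+x. ennreal (if l \<le> x \<and> x < r then 1 / (d - x) else 0) \<partial>lborel) = ennreal (ln ((d - l) / (d - r)))"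
proof -
  have "(\<integral>\<^sup>+x. ennreal (if l \<le> x \<and> x < r then 1 / (d - x) else 0) \<partial>lborel)
    = (\<integral>\<^sup>+x. ennreal (1 / (d - x)) * indicator {l..r} x \<partial>lborel)"
    using AE_lborel_singleton[of r] by (intro nn_integral_cong_AE) (auto split: split_indicator)
  also have "\<dots> = ennreal (- ln (d - r) - - ln (d - l))"
  proof (rule nn_integral_FTC_Icc[where F = "\<lambda>x. - ln (d - x)"])
    show "DERIV (\<lambda>x. - ln (d - x)) x :> 1 / (d - x)" if "x \<in> {l..r}" for x
      using assms that
      by (auto intro!: derivative_eq_intros)
  qed (use assms in auto)
  finally show ?thesis using assms by (simp add: ln_div)
qed

section \<open>The invariant domain\<close>

locale gauss_params =
  fixes a b :: real and m :: nat
  assumes a_ge: "- 1 \<le> a" and a_neg: "a < 0" and b_pos: "0 < b" and b_le: "b \<le> 1"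
    and m_ge: "1 \<le> m" and ab: "a * (b + 1) \<le> - 1"
    and lo: "a \<le> real m - 1 / b" and hi: "real m - 1 / b \<le> a + 1"
begin

text \<open>\<open>t p = (T2S ^^ p) (b - 1)\<close> for \<open>p < m\<close>, see \<open>T2S_iterate\<close> below.\<close>

definition t :: "nat \<Rightarrow> real" where "t p = 1 / (1 / b - real p) - 1"

text \<open>The regions under \<open>h_plus\<close> and \<open>h_minus\<close>.  The bounds on \<open>\<bar>y\<bar>\<close> are monotone in \<open>p\<close>, so
  imposing all applicable ones describes the step function.\<close>

definition Pplus :: "(real \<times> real) set" where
  "Pplus = {(x, y). b - 1 \<le> x \<and> x < b \<and> 0 \<le> y \<and> y \<le> 1
     \<and> (\<forall>p\<in>{1..<m}. x < t p \<longrightarrow> y \<le> real p / (real p + 1))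
     \<and> (x < - 1 / a - 1 \<longrightarrow> y \<le> real m / (real m + 1))}"

definition Pminus :: "(real \<times> real) set" where
  "Pminus = {(x, y). a \<le> x \<and> x < a + 1 \<and> - 1 / real m \<le> y \<and> y \<le> 0
     \<and> (real m - 1 / b \<le> x \<longrightarrow> - 1 / (real m + 1) \<le> y)}"

definition Dom :: "(real \<times> real) set" where "Dom = Pplus \<union> Pminus"

lemma a_le_inv: "a \<le> - 1 / (b + 1)"
  using ab b_pos by (simp add: field_simps)

lemma a_succ_lt: "a + 1 < b"
proof -
  have "a + 1 \<le> b / (b + 1)" using ab b_pos by (simp add: field_simps)
  also have "\<dots> < b" using b_pos by (simp add: field_simps)
  finally show ?thesis .
qed

lemma inv_a_bounds: "1 \<le> - 1 / a" "- 1 / a \<le> b + 1"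
  using a_ge a_neg ab by (auto simp: field_simps)

lemma inv_b_ge: "1 \<le> 1 / b" using b_pos b_le by (simp add: field_simps)

lemma t_less_iff:
  assumes "real p \<le> real m - 1" "0 < x + 1"
  shows "x < t p \<longleftrightarrow> (x + 1) * (1 / b - real p) < 1"
proof -
  have "0 < 1 / b - real p" using hi a_neg assms(1) by linarith
  then have "(x + 1) * (1 / b - real p) < 1 \<longleftrightarrow> x + 1 < 1 / (1 / b - real p)"
    by (simp only: pos_less_divide_eq)
  then show ?thesis unfolding t_def by linarith
qed

lemma t_le_last: assumes "real p \<le> real m - 1" shows "t p \<le> - 1 / a - 1"
proof -
  have "- a \<le> 1 / b - real p" using hi assms by linarith
  then have "1 / (1 / b - real p) \<le> 1 / (- a)" using a_neg by (intro divide_left_mono mult_pos_pos) auto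
  then show ?thesis by (simp add: t_def)
qed

lemma t_0: "t 0 = b - 1" by (simp add: t_def)

text \<open>Every step height \<open>p / (p + 1)\<close> with \<open>p \<ge> 1\<close> is at least
  1/2. Returns from negative \<open>x\<close> after a long run of translations land here.\<close>

lemma Dom_plus_half:
  assumes "b - 1 \<le> x" "x < b" "0 \<le> y" "y \<le> 1 / 2" shows "(x, y) \<in> Dom"
proof -
  have "y \<le> real p / (real p + 1)" if "1 \<le> p" for p
    using half_le[OF that] assms(4) by linarith
  then show ?thesis using assms m_ge by (simp add: Dom_def Pplus_def)
qed

lemma Dom_plus_right:
  assumes "- 1 / a - 1 \<le> x" "x < b" "0 \<le> y" "y \<le> 1" shows "(x, y) \<in> Dom"
proof -
  have "t p \<le> x" if "p \<in> {1..<m}" for p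
    using t_le_last[of p] that assms(1) m_ge by (auto simp: of_nat_diff)
  moreover have "b - 1 \<le> x" using assms(1) inv_a_bounds(1) b_le by linarith
  ultimately show ?thesis using assms by (fastforce simp: Dom_def Pplus_def)
qed

lemma Dom_minus:
  assumes "a \<le> x" "x < a + 1" "real m \<le> v" "real m - 1 / b \<le> x \<Longrightarrow> real m + 1 \<le> v"
  shows "(x, - 1 / v) \<in> Dom"
proof -
  have v: "0 < v" using assms(3) m_ge by linarith
  have "- 1 / real m \<le> - 1 / v" using assms(3) v m_ge by (simp add: field_simps)
  moreover have "- 1 / (real m + 1) \<le> - 1 / v" if "real m - 1 / b \<le> x"
    using assms(4)[OF that] v by (simp add: field_simps)
  ultimately show ?thesis using assms v by (auto simp: Dom_def Pminus_def)
qed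

text \<open>The two branches of the Gauss-type map: the integer part of \<open>- 1 / x\<close> is \<open>n\<close> for \<open>x < 0\<close>
  and \<open>- k\<close> for \<open>x > 0\<close>.\<close>

definition neg_step :: "real \<Rightarrow> nat \<Rightarrow> real \<Rightarrow> bool" where
  "neg_step x n x' \<longleftrightarrow> a \<le> x \<and> x < 0 \<and> 1 \<le> n \<and> x' = - 1 / x - real n \<and> b - 1 \<le> x' \<and> x' < b"

definition pos_step :: "real \<Rightarrow> nat \<Rightarrow> real \<Rightarrow> bool" where
  "pos_step x k x' \<longleftrightarrow> 0 < x \<and> x < b \<and> 1 \<le> k \<and> x' = - 1 / x + real k \<and> a \<le> x' \<and> x' < a + 1"

lemma neg_step_exists:
  assumes "a \<le> x" "x < 0" obtains n x' where "neg_step x n x'"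
proof -
  have "- 1 / a \<le> - 1 / x" using assms a_neg by (simp add: field_simps)
  then have X: "b \<le> - 1 / x" using inv_a_bounds b_le by linarith
  define n where "n = nat (\<lfloor>- 1 / x - b\<rfloor> + 1)"
  have "real n = of_int \<lfloor>- 1 / x - b\<rfloor> + 1" using X by (simp add: n_def)
  moreover have "1 \<le> n" using X unfolding n_def by linarith
  ultimately have "neg_step x n (- 1 / x - real n)"
    unfolding neg_step_def using assms by (intro conjI; linarith)
  then show ?thesis by (rule that)
qed

lemma pos_step_exists:
  assumes "0 < x" "x < b" obtains k x' where "pos_step x k x'"
proof -
  have "- 1 / x < - (1 / b)" using assms by (simp add: field_simps)
  then have X: "- 1 / x < a" using inv_b_ge a_ge by linarith
  define k where "k = nat (- \<lfloor>- 1 / x - a\<rfloor>)"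
  have "real k = - of_int \<lfloor>- 1 / x - a\<rfloor>" using X by (simp add: k_def)
  moreover have "1 \<le> k" using X unfolding k_def by linarith
  ultimately have "pos_step x k (- 1 / x + real k)"
    unfolding pos_step_def using assms by (intro conjI; linarith)
  then show ?thesis by (rule that)
qed

lemma neg_step_ge: assumes "neg_step x n x'" shows "- 1 / a \<le> x' + real n"
proof -
  have "- 1 / a \<le> - 1 / x" using assms a_neg by (simp add: neg_step_def field_simps)
  then show ?thesis using assms by (simp add: neg_step_def)
qed

lemma neg_step_x: assumes "neg_step x n x'" shows "x = - 1 / (x' + real n)"
  using assms by (simp add: neg_step_def)

text \<open>A single translation requires \<open>x < - 1 / (b + 1)\<close>, whereas
  \<open>(b - 1) * (b + 1) = b * b - 1 \<ge> - 1\<close>.\<close>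

lemma neg_step_one: assumes "neg_step x n x'" "b - 1 \<le> x" shows "2 \<le> n"
proof (rule ccontr)
  assume "\<not> 2 \<le> n"
  then have n: "n = 1" using assms(1) by (simp add: neg_step_def)
  have "- 1 / x < b + 1" "x < 0" using assms(1) n by (auto simp: neg_step_def)
  then have "x * (b + 1) < - 1" by (simp add: field_simps)
  moreover have "(b - 1) * (b + 1) \<le> x * (b + 1)" using assms b_pos by (intro mult_right_mono) auto
  moreover have "(b - 1) * (b + 1) \<ge> - 1" by (simp add: algebra_simps)
  ultimately show False by linarith
qed

lemma pos_step_x: assumes "pos_step x k x'" shows "x = 1 / (real k - x')"
  using assms by (simp add: pos_step_def)

lemma pos_step_lt: assumes "pos_step x k x'" shows "x' < real k - 1 / b"
proof -
  have "1 / b < 1 / x" using assms by (simp add: pos_step_def frac_less2)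
  then show ?thesis using assms by (simp add: pos_step_def)
qed

lemma pos_step_ge_m: assumes "pos_step x k x'" shows "m \<le> k"
proof -
  have "a < real k - 1 / b" using pos_step_lt[OF assms] assms by (simp add: pos_step_def)
  then have "real m < real k + 1" using hi by linarith
  then show ?thesis by linarith
qed

text \<open>Since \<open>ab\<close> gives \<open>a + 1 \<le> b / (b + 1)\<close>,
  \<open>1 / x\<close> exceeds \<open>1 / b + 1\<close>: such an \<open>x\<close> needs at least one
  translation more than the general minimum \<open>m\<close>.\<close>

lemma pos_step_small:
  assumes "pos_step x k x'" "x < a + 1"
  shows "m + 1 \<le> k" "k = m + 1 \<Longrightarrow> x' < real m - 1 / b"
proof -
  have x: "0 < x" using assms by (simp add: pos_step_def)
  then have a1: "0 < a + 1" using assms(2) by linarith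
  have "1 / (a + 1) < 1 / x" using assms(2) x a1 by (simp add: frac_less2)
  moreover have "1 / b + 1 \<le> 1 / (a + 1)"
    using ab b_pos a1 by (simp add: field_simps)
  ultimately have gt: "1 / b + 1 < 1 / x" by linarith
  have x': "x' = - 1 / x + real k" "a \<le> x'" using assms by (auto simp: pos_step_def)
  have "a < real k - 1 / b - 1" using gt x' by simp
  then have "real m < real k" using hi by linarith
  then show "m + 1 \<le> k" by linarith
  show "x' < real m - 1 / b" if "k = m + 1" using gt x' that by simp
qed

section \<open>Forward invariance of the domain\<close>

lemma neg_step_far:
  assumes "neg_step x n x'" "2 \<le> real n - y" shows "(x', 1 / (real n - y)) \<in> Dom"
  using assms by (intro Dom_plus_half) (auto simp: neg_step_def field_simps)

lemma neg_step_nonpos: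
  assumes "neg_step x n x'" "y \<le> 0" shows "(x', 1 / (real n - y)) \<in> Dom"
proof (cases "n = 1")
  case True
  then have "- 1 / a - 1 \<le> x'" "x' < b" using neg_step_ge[OF assms(1)] assms(1) by (auto simp: neg_step_def)
  then show ?thesis using True assms(2) by (intro Dom_plus_right) (auto simp: field_simps)
next
  case False
  then have "2 \<le> real n" using assms by (simp add: neg_step_def)
  then show ?thesis using assms by (intro neg_step_far) auto
qed

lemma pos_step_far:
  assumes "pos_step x k x'" "real m + 1 \<le> y + real k" shows "(x', - 1 / (y + real k)) \<in> Dom"
  using assms by (intro Dom_minus) (auto simp: pos_step_def)

lemma pos_step_nonneg:
  assumes "pos_step x k x'" "0 \<le> y" shows "(x', - 1 / (y + real k)) \<in> Dom"
proof (cases "k = m")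
  case True
  then show ?thesis using assms pos_step_lt[OF assms(1)]
    by (intro Dom_minus) (auto simp: pos_step_def)
next
  case False
  then have "real m + 1 \<le> real k" using pos_step_ge_m[OF assms(1)] by linarith
  then show ?thesis using assms by (intro pos_step_far) auto
qed

lemma pos_step_left:
  assumes "pos_step x k x'" "x < a + 1" "- 1 \<le> y" shows "(x', - 1 / (y + real k)) \<in> Dom"
proof (cases "k = m + 1")
  case True
  then show ?thesis using assms pos_step_small(2)[OF assms(1,2)]
    by (intro Dom_minus) (auto simp: pos_step_def)
next
  case False
  then have "real m + 2 \<le> real k" using pos_step_small(1)[OF assms(1,2)] by linarith
  then show ?thesis using assms by (intro pos_step_far) auto
qed

text \<open>The delicate case is \<open>n = 2\<close>: the map \<open>x' = - 1 / x - 2\<close>,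
  \<open>y' = 1 / (2 - y)\<close> carries the breakpoint \<open>t (p - 1)\<close> to
  \<open>t p\<close> and the height \<open>p / (p + 1)\<close> to \<open>(p + 1) / (p + 2)\<close>,
  so steps go to steps.\<close>

lemma neg_step_plus:
  assumes st: "neg_step x n x'" and D: "(x, y) \<in> Pplus" shows "(x', 1 / (real n - y)) \<in> Dom"
proof (cases "n = 2")
  case False
  then have "3 \<le> n" using neg_step_one[OF st] D by (auto simp: Pplus_def)
  then show ?thesis using D by (intro neg_step_far[OF st]) (auto simp: Pplus_def)
next
  case True
  have y: "0 \<le> y" "y \<le> 1" "b - 1 \<le> x" and yp: "\<And>p. 1 \<le> p \<Longrightarrow> p < m \<Longrightarrow> x < t p \<Longrightarrow> y \<le> real p / (real p + 1)"
    using D by (auto simp: Pplus_def)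
  have x: "x' = - 1 / x - 2" "x < 0" "b - 1 \<le> x'" "x' < b" using st True by (auto simp: neg_step_def)
  have x1: "0 < x + 1" "0 < x' + 1" using y x b_pos by linarith+
  have xx: "x * (x' + 2) = - 1" using x by simp
  have up: "1 / (2 - y) \<le> (real p + 1) / (real p + 2)" if "y \<le> real p / (real p + 1)" for p
  proof -
    have "y * (real p + 1) \<le> real p" using that by (simp add: field_simps)
    then show ?thesis using y by (simp add: field_simps)
  qed
  \<comment> \<open>The product form of \<open>x' < t q\<close> also covers \<open>q = m\<close>,
    where \<open>1 / b - real m\<close> need not be positive. By \<open>lo\<close>, the condition
    \<open>x' < - 1 / a - 1\<close> implies this product form.\<close>
  have key: "1 / (2 - y) \<le> real q / (real q + 1)"
    if q: "1 \<le> q" "q \<le> m" "(x' + 1) * (1 / b - real q) < 1" for q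
  proof -
    have "(x' + 1) * (1 / b - real q) = (x' + 2) * ((x + 1) * (1 / b - (real q - 1)) - 1) + 1"
    proof -
      have "(x' + 2) * (x + 1) = x' + 1" using xx by (simp add: algebra_simps)
      then have "(x' + 2) * ((x + 1) * (1 / b - (real q - 1)) - 1) + 1 = (x' + 1) * (1 / b - (real q - 1)) - (x' + 2) + 1"
        by (metis (no_types, lifting) mult.assoc mult.right_neutral right_diff_distrib)
      then show ?thesis by (simp add: algebra_simps)
    qed
    then have "(x' + 2) * ((x + 1) * (1 / b - (real q - 1)) - 1) < 0" using q(3) by linarith
    then have lt: "(x + 1) * (1 / b - (real q - 1)) < 1" using x1 by (simp add: mult_less_0_iff)
    have "q \<noteq> 1"
    proof
      assume "q = 1"
      then have "(x + 1) * (1 / b) < 1" using lt by simp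
      then have "x + 1 < b" using b_pos by (simp add: field_simps)
      then show False using y by simp
    qed
    then have q2: "1 \<le> q - 1" "q - 1 < m" "real (q - 1) = real q - 1" using q by auto
    have "x < t (q - 1)" using lt q q2(3) x1 by (subst t_less_iff) auto
    from up[OF yp[OF q2(1,2) this]] show ?thesis unfolding q2(3) by (simp add: add.commute)
  qed
  have "1 / (2 - y) \<le> real m / (real m + 1)" if "x' < - 1 / a - 1"
  proof (rule key[OF m_ge order_refl])
    have "x' + 1 < 1 / (- a)" using that by simp
    then have "(x' + 1) * (- a) < 1" using a_neg by (simp add: field_simps)
    moreover have "(x' + 1) * (1 / b - real m) \<le> (x' + 1) * (- a)" using lo x1 by (intro mult_left_mono) auto
    ultimately show "(x' + 1) * (1 / b - real m) < 1" by linarith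
  qed
  moreover have "1 / (2 - y) \<le> real p / (real p + 1)" if "p \<in> {1..<m}" "x' < t p" for p
    using that x1 by (intro key) (auto simp: t_less_iff of_nat_diff)
  ultimately show ?thesis using x y True
    by (auto simp: Dom_def Pplus_def)
qed

lemma Dom_bounds:
  assumes "(x, y) \<in> Dom" shows "a \<le> x" "x < b" "- 1 \<le> y" "y \<le> 1"
proof -
  have "- 1 \<le> - 1 / real m" using m_ge by (simp add: field_simps)
  then show "a \<le> x" "x < b" "- 1 \<le> y" "y \<le> 1"
    using assms a_succ_lt by (auto simp: Dom_def Pplus_def Pminus_def)
qed

lemma Dom_neg_step:
  assumes "neg_step x n x'" "(x, y) \<in> Dom" shows "(x', 1 / (real n - y)) \<in> Dom"
  using assms(2) neg_step_plus[OF assms(1)] neg_step_nonpos[OF assms(1)]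
  by (cases "(x, y) \<in> Pplus") (auto simp: Pminus_def Dom_def)

lemma Dom_pos_step:
  assumes "pos_step x k x'" "(x, y) \<in> Dom" shows "(x', - 1 / (y + real k)) \<in> Dom"
proof (cases "0 \<le> y")
  case True
  then show ?thesis using assms pos_step_nonneg by blast
next
  case False
  then have "x < a + 1" using assms by (auto simp: Dom_def Pplus_def Pminus_def)
  then show ?thesis using assms Dom_bounds pos_step_left by blast
qed

section \<open>Trapping of orbits\<close>

text \<open>Since \<open>y = - 1 / u\<close>, the value \<open>y = 0\<close> stands for \<open>u = \<infinity>\<close>, and \<open>u = 0\<close> is not of the form \<open>pt x y\<close>.\<close>

definition pt :: "real \<Rightarrow> real \<Rightarrow> rbar \<times> rbar" where "pt x y = (S (Some y), Some x)"

definition strip :: "rbar \<times> rbar \<Rightarrow> bool" where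
  "strip z \<longleftrightarrow> (\<exists>x. snd z = Some x \<and> a \<le> x \<and> x < b)"

definition in_Dom :: "rbar \<times> rbar \<Rightarrow> bool" where
  "in_Dom z \<longleftrightarrow> (\<exists>x y. z = pt x y \<and> (x, y) \<in> Dom)"

definition trapped :: "nat \<Rightarrow> rbar \<times> rbar \<Rightarrow> bool" where
  "trapped N z \<longleftrightarrow> (\<forall>k\<ge>N. strip ((F a b ^^ k) z) \<longrightarrow> in_Dom ((F a b ^^ k) z))"

lemma trapped_mono: "trapped N z \<Longrightarrow> N \<le> N' \<Longrightarrow> trapped N' z"
  by (simp add: trapped_def)

lemma trapped_later: 
  assumes "trapped N ((F a b ^^ j) z)" shows "trapped (N + j) z"
  unfolding trapped_def
proof (intro allI impI)
  fix k assume k: "N + j \<le> k" and s: "strip ((F a b ^^ k) z)"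
  have "(F a b ^^ k) z = (F a b ^^ (k - j)) ((F a b ^^ j) z)"
    using k by (simp flip: funpow_add comp_apply[of "F a b ^^ (k - j)"])
  then show "in_Dom ((F a b ^^ k) z)" using assms k s by (simp add: trapped_def)
qed

text \<open>Unlike \<open>trapped_later\<close>, this adds nothing for the steps up to
  \<open>j\<close>, because the orbit stays off the strip between \<open>N\<close> and
  \<open>j\<close>. It yields delays independent of the length of a run of translations.\<close>

lemma trapped_first:
  assumes "trapped 0 ((F a b ^^ j) z)" "\<And>i. N \<le> i \<Longrightarrow> i < j \<Longrightarrow> \<not> strip ((F a b ^^ i) z)"
  shows "trapped N z"
  using trapped_later[OF assms(1)] assms(2) by (auto simp: trapped_def not_less) (meson not_le)

section \<open>Iterates of \<open>F\<close> along one return\<close>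

lemma F_strip: "a \<le> x \<Longrightarrow> x < b \<Longrightarrow> F a b (u, Some x) = (S u, S (Some x))"
  by (simp add: F_def)

lemma F_above: "b \<le> Y \<Longrightarrow> F a b (u, Some Y) = (shift (- 1) u, Some (Y - 1))"
  using a_neg b_pos by (simp add: F_def shift_def)

lemma F_below: "Y < a \<Longrightarrow> F a b (u, Some Y) = (shift 1 u, Some (Y + 1))"
  by (simp add: F_def shift_def)

lemma F_down:
  assumes "\<And>i. i < n \<Longrightarrow> b \<le> X - real i"
  shows "(F a b ^^ n) (u, Some X) = (shift (- real n) u, Some (X - real n))"
  using assms
proof (induction n)
  case 0
  then show ?case by (cases u) (auto simp: shift_def)
next
  case (Suc n)
  have "b \<le> X - real n" using Suc.prems by simp
  then show ?case using Suc by (simp add: F_above shift_shift algebra_simps)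
qed

lemma F_up:
  assumes "\<And>i. i < n \<Longrightarrow> X + real i < a"
  shows "(F a b ^^ n) (u, Some X) = (shift (real n) u, Some (X + real n))"
  using assms
proof (induction n)
  case 0
  then show ?case by (cases u) (auto simp: shift_def)
next
  case (Suc n)
  have "X + real n < a" using Suc.prems by simp
  then show ?case using Suc by (simp add: F_below shift_shift algebra_simps)
qed

lemma F_neg_step:
  assumes "neg_step x n x'"
  shows "(F a b ^^ Suc n) (u, Some x) = (shift (- real n) (S u), Some x')"
    and "1 \<le> i \<Longrightarrow> i < Suc n \<Longrightarrow> \<not> strip ((F a b ^^ i) (u, Some x))"
proof -
  have x: "a \<le> x" "x < 0" "x < b" using assms b_pos by (auto simp: neg_step_def)
  have S: "F a b (u, Some x) = (S u, Some (- 1 / x))" using F_strip[OF x(1,3)] x by simp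
  have ge: "b \<le> - 1 / x - real j" if "j < n" for j
  proof -
    have "real j + 1 \<le> real n" using that by linarith
    then show ?thesis using assms unfolding neg_step_def by linarith
  qed
  have it: "(F a b ^^ Suc j) (u, Some x) = (shift (- real j) (S u), Some (- 1 / x - real j))" if "j \<le> n" for j
    using that ge F_down[of j "- 1 / x" "S u"] by (simp add: S funpow_swap1 del: funpow.simps(2) add: funpow_Suc_right)
  show "(F a b ^^ Suc n) (u, Some x) = (shift (- real n) (S u), Some x')"
    using it[of n] assms by (simp add: neg_step_def)
  show "\<not> strip ((F a b ^^ i) (u, Some x))" if "1 \<le> i" "i < Suc n"
    using it[of "i - 1"] ge[of "i - 1"] that by (cases i) (auto simp: strip_def)
qed

lemma F_pos_step:
  assumes "pos_step x k x'"
  shows "(F a b ^^ Suc k) (u, Some x) = (shift (real k) (S u), Some x')"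
    and "1 \<le> i \<Longrightarrow> i < Suc k \<Longrightarrow> \<not> strip ((F a b ^^ i) (u, Some x))"
proof -
  have x: "a \<le> x" "0 < x" "x < b" using assms a_neg by (auto simp: pos_step_def)
  have S: "F a b (u, Some x) = (S u, Some (- 1 / x))" using F_strip[OF x(1,3)] x by simp
  have ge: "- 1 / x + real j < a" if "j < k" for j
  proof -
    have "real j + 1 \<le> real k" using that by linarith
    then show ?thesis using assms unfolding pos_step_def by linarith
  qed
  have it: "(F a b ^^ Suc j) (u, Some x) = (shift (real j) (S u), Some (- 1 / x + real j))" if "j \<le> k" for j
    using that ge F_up[of j "- 1 / x" "S u"] by (simp add: S del: funpow.simps(2) add: funpow_Suc_right)
  show "(F a b ^^ Suc k) (u, Some x) = (shift (real k) (S u), Some x')"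
    using it[of k] assms by (simp add: pos_step_def)
  show "\<not> strip ((F a b ^^ i) (u, Some x))" if "1 \<le> i" "i < Suc k"
    using it[of "i - 1"] ge[of "i - 1"] that by (cases i) (auto simp: strip_def)
qed

lemma pt_neg: "y \<noteq> real n \<Longrightarrow> pt x' (1 / (real n - y)) = (shift (- real n) (S (S (Some y))), Some x')"
  by (auto simp: pt_def shift_def divide_simps)

lemma pt_pos: "y + real k \<noteq> 0 \<Longrightarrow> pt x' (- 1 / (y + real k)) = (shift (real k) (S (S (Some y))), Some x')"
  by (auto simp: pt_def shift_def divide_simps)

lemma pt_inject: "pt x y = pt x' y' \<longleftrightarrow> x = x' \<and> y = y'"
  by (auto simp: pt_def split: if_splits)

lemma Dom_imp_in_Dom: "(x, y) \<in> Dom \<Longrightarrow> in_Dom (pt x y)"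
  by (auto simp: in_Dom_def)

lemma strip_pt: "strip (pt x y) \<longleftrightarrow> a \<le> x \<and> x < b"
  by (simp add: strip_def pt_def)

text \<open>\<open>F\<close> sends second coordinate 0 to infinity and then fixes it, so there is no
  return; the convention that the Gauss-type map fixes 0 has no counterpart for
  \<open>F\<close>.\<close>

lemma strip_zero: "1 \<le> k \<Longrightarrow> \<not> strip ((F a b ^^ k) (u, Some 0))"
proof -
  have "snd ((F a b ^^ Suc k) (u, Some 0)) = None" for k
  proof (induction k)
    case 0
    then show ?case using a_neg b_pos by (simp add: F_def)
  next
    case (Suc k)
    obtain v where "(F a b ^^ Suc k) (u, Some 0) = (v, None)" using Suc by (metis prod.collapse)
    then show ?case by (simp add: F_def shift_def)
  qed
  from this[of "k - 1"] show "1 \<le> k \<Longrightarrow> \<not> strip ((F a b ^^ k) (u, Some 0))" by (simp add: strip_def)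
qed

lemma trapped_zero: "trapped 1 (u, Some 0)"
  using strip_zero by (simp add: trapped_def)

lemma Dom_neg_step_less:
  assumes "neg_step x n x'" "(x, y) \<in> Dom" shows "y < real n"
proof (cases "y \<le> 0")
  case True then show ?thesis using assms by (auto simp: neg_step_def)
next
  case False
  then have "(x, y) \<in> Pplus" using assms by (auto simp: Dom_def Pminus_def)
  then show ?thesis using neg_step_one[OF assms(1)] by (auto simp: Pplus_def)
qed

lemma Dom_pos_step_less:
  assumes "pos_step x k x'" "(x, y) \<in> Dom" shows "0 < y + real k"
proof (cases "y \<ge> 0")
  case True then show ?thesis using assms by (auto simp: pos_step_def)
next
  case False
  then have "x < a + 1" using assms by (auto simp: Dom_def Pplus_def Pminus_def)
  then show ?thesis using pos_step_small(1)[OF assms(1)] Dom_bounds[OF assms(2)] m_ge by fastforce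
qed

lemma Dom_F_invariant:
  assumes "(x, y) \<in> Dom" "strip ((F a b ^^ k) (pt x y))"
  shows "in_Dom ((F a b ^^ k) (pt x y))"
  using assms
proof (induction k arbitrary: x y rule: less_induct)
  case (less k)
  note bd = Dom_bounds[OF less.prems(1)]
  \<comment> \<open>Induction along returns: if the next return is in \<open>Dom\<close> after
    \<open>j\<close> steps, then \<open>k < j\<close> forces \<open>k = 0\<close>, and otherwise the
    induction hypothesis applies to \<open>k - j\<close>.\<close>
  have next_pt: ?case if "1 \<le> j" "(F a b ^^ j) (pt x y) = pt x' y'" "(x', y') \<in> Dom"
      "\<And>i. 1 \<le> i \<Longrightarrow> i < j \<Longrightarrow> \<not> strip ((F a b ^^ i) (pt x y))" for j x' y'
  proof (cases "k < j")
    case True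
    then have "k = 0" using that(4)[of k] less.prems(2) by (cases k) auto
    then show ?thesis using less.prems(1) by (simp add: Dom_imp_in_Dom)
  next
    case False
    then have "(F a b ^^ k) (pt x y) = (F a b ^^ (k - j)) (pt x' y')"
      using that(2) by (simp flip: comp_apply[of "F a b ^^ (k - j)"] funpow_add that(2))
    then show ?thesis using less.IH[of "k - j", OF _ that(3)] less.prems(2) that(1) False by simp
  qed
  consider "x = 0" | "x < 0" | "0 < x" by linarith
  then show ?case
  proof cases
    case 1
    then have "k = 0" using strip_zero[of k] less.prems(2) by (cases k) (auto simp: pt_def)
    then show ?thesis using less.prems(1) by (simp add: Dom_imp_in_Dom)
  next
    case 2
    obtain n x' where st: "neg_step x n x'" using neg_step_exists[OF bd(1) 2] .
    show ?thesis
      using F_neg_step[OF st] Dom_neg_step_less[OF st less.prems(1)] pt_neg[of y n x']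
      by (intro next_pt[of "Suc n", OF _ _ Dom_neg_step[OF st less.prems(1)]]) (auto simp: pt_def)
  next
    case 3
    obtain k' x' where st: "pos_step x k' x'" using pos_step_exists[OF 3 bd(2)] .
    show ?thesis
      using F_pos_step[OF st] Dom_pos_step_less[OF st less.prems(1)] pt_pos[of y k' x']
      by (intro next_pt[of "Suc k'", OF _ _ Dom_pos_step[OF st less.prems(1)]]) (auto simp: pt_def)
  qed
qed

lemma trapped_Dom: "(x, y) \<in> Dom \<Longrightarrow> trapped 0 (pt x y)"
  using Dom_F_invariant by (simp add: trapped_def)

lemma trapped_neg:
  assumes "neg_step x n x'" "trapped N (shift (- real n) (S u), Some x')"
  shows "trapped (N + Suc n) (u, Some x)"
  using trapped_later[of N "Suc n" "(u, Some x)"] F_neg_step(1)[OF assms(1), of u] assms(2) by simp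

lemma trapped_pos:
  assumes "pos_step x k x'" "trapped N (shift (real k) (S u), Some x')"
  shows "trapped (N + Suc k) (u, Some x)"
  using trapped_later[of N "Suc k" "(u, Some x)"] F_pos_step(1)[OF assms(1), of u] assms(2) by simp

section \<open>Points that enter the domain at the next return\<close>

lemma trapped_neg_Dom:
  assumes "neg_step x n x'" "y \<noteq> real n" "(x', 1 / (real n - y)) \<in> Dom"
  shows "trapped 1 (pt x y)"
  unfolding pt_def
  by (rule trapped_first[of "Suc n"])
    (use assms trapped_Dom[OF assms(3)] F_neg_step[OF assms(1)] pt_neg[OF assms(2)] in auto)

lemma trapped_pos_Dom:
  assumes "pos_step x k x'" "y + real k \<noteq> 0" "(x', - 1 / (y + real k)) \<in> Dom"
  shows "trapped 1 (pt x y)"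
  unfolding pt_def
  by (rule trapped_first[of "Suc k"])
    (use assms trapped_Dom[OF assms(3)] F_pos_step[OF assms(1)] pt_pos[OF assms(2)] in auto)

lemma trapped_neg_nonpos:
  assumes "a \<le> x" "x < 0" "y \<le> 0" shows "trapped 1 (pt x y)"
proof -
  obtain n x' where st: "neg_step x n x'" using neg_step_exists[OF assms(1,2)] .
  show ?thesis using st assms neg_step_nonpos[OF st]
    by (intro trapped_neg_Dom[OF st]) (auto simp: neg_step_def)
qed

lemma trapped_pos_nonneg:
  assumes "0 < x" "x < b" "0 \<le> y" shows "trapped 1 (pt x y)"
proof -
  obtain n x' where st: "pos_step x n x'" using pos_step_exists[OF assms(1,2)] .
  show ?thesis using st assms pos_step_nonneg[OF st]
    by (intro trapped_pos_Dom[OF st]) (auto simp: pos_step_def)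
qed

lemma trapped_pos_left:
  assumes "0 < x" "x < a + 1" "- 1 \<le> y" shows "trapped 1 (pt x y)"
proof -
  have "x < b" using assms a_succ_lt by simp
  obtain n x' where st: "pos_step x n x'" using pos_step_exists[OF assms(1) \<open>x < b\<close>] .
  show ?thesis using assms pos_step_left[OF st] pos_step_small(1)[OF st] m_ge
    by (intro trapped_pos_Dom[OF st]) auto
qed

lemma Dom_axis: "b - 1 \<le> x \<and> x < b \<or> a \<le> x \<and> x < a + 1 \<Longrightarrow> (x, 0) \<in> Dom"
  using Dom_plus_half[of x 0] by (auto simp: Dom_def Pminus_def)

text \<open>Inversion sends \<open>u = 0\<close> to infinity, that is to \<open>y = 0\<close>, which
  translations fix. The return therefore lands on the axis \<open>y = 0\<close> of
  \<open>Dom\<close>.\<close>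

lemma trapped_origin:
  assumes "a \<le> x" "x < b" shows "trapped 1 (Some 0, Some x)"
proof -
  consider "x = 0" | "x < 0" | "0 < x" by linarith
  then show ?thesis
  proof cases
    case 1 then show ?thesis using trapped_zero by simp
  next
    case 2
    obtain n x' where st: "neg_step x n x'" using neg_step_exists[OF assms(1) 2] .
    then have D: "(x', 0) \<in> Dom" by (intro Dom_axis) (simp add: neg_step_def)
    show ?thesis
      by (rule trapped_first[of "Suc n"])
        (use trapped_Dom[OF D] F_neg_step[OF st] in \<open>auto simp: pt_def shift_def\<close>)
  next
    case 3
    obtain n x' where st: "pos_step x n x'" using pos_step_exists[OF 3 assms(2)] .
    then have D: "(x', 0) \<in> Dom" by (intro Dom_axis) (simp add: pos_step_def)
    show ?thesis
      by (rule trapped_first[of "Suc n"])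
        (use trapped_Dom[OF D] F_pos_step[OF st] in \<open>auto simp: pt_def shift_def\<close>)
  qed
qed

lemma Some_eq_pt: "r \<noteq> 0 \<Longrightarrow> (Some r, Some x) = pt x (- 1 / r)"
  by (simp add: pt_def)

text \<open>With at least \<open>m + 2\<close> translations, \<open>y \<ge> - 1\<close> is good
  enough to land in \<open>Dom\<close>. Otherwise the return takes at most \<open>m + 2\<close>
  steps and reaches \<open>r = y + k \<ge> 0\<close>, from where the next return, if any, is in
  \<open>Dom\<close>.\<close>

lemma trapped_small_pos:
  assumes "0 < x" "x < b" "- 1 \<le> y" shows "trapped (m + 4) (pt x y)"
proof (cases "0 \<le> y")
  case True
  then show ?thesis using trapped_pos_nonneg[OF assms(1,2)] trapped_mono by fastforce
next
  case False
  then have y0: "y < 0" by simp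
  obtain k x' where st: "pos_step x k x'" using pos_step_exists[OF assms(1,2)] .
  have x': "a \<le> x'" "x' < a + 1" "x' < b" using st a_succ_lt by (auto simp: pos_step_def)
  show ?thesis
  proof (cases "m + 2 \<le> k")
    case True
    have "trapped 1 (pt x y)" using True assms m_ge
      by (intro trapped_pos_Dom[OF st] pos_step_far[OF st]) auto
    then show ?thesis using trapped_mono by fastforce
  next
    case False
    have km: "1 \<le> real k" "real m \<le> real k" using pos_step_ge_m[OF st] m_ge by auto
    define r where "r = y + real k"
    have r: "0 \<le> r" using assms km by (simp add: r_def)
    have "trapped 1 (Some r, Some x')"
    proof (cases "r = 0")
      case True then show ?thesis using trapped_origin x' by simp
    next
      case False
      with r have r0: "0 < r" by simp
      consider "x' = 0" | "x' < 0" | "0 < x'" by linarith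
      then show ?thesis
      proof cases
        case 1 then show ?thesis using trapped_zero by simp
      next
        case 2
        have "trapped 1 (pt x' (- 1 / r))" using 2 r0 x' by (intro trapped_neg_nonpos) auto
        then show ?thesis using r0 by (subst Some_eq_pt) auto
      next
        case 3
        have "k \<noteq> 1"
        proof
          assume k: "k = 1"
          then have "x' < 1 - 1 / b" using pos_step_lt[OF st] by simp
          then show False using 3 inv_b_ge by linarith
        qed
        then have "1 \<le> r" using km assms by (simp add: r_def)
        then have "- 1 \<le> - 1 / r" by (simp add: field_simps)
        then have "trapped 1 (pt x' (- 1 / r))" using 3 x' by (intro trapped_pos_left) auto
        then show ?thesis using r0 by (subst Some_eq_pt) auto
      qed
    qed
    then have "trapped (1 + Suc k) (S (Some y), Some x)"
      using y0 by (intro trapped_pos[OF st]) (simp add: shift_def r_def)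
    then show ?thesis using False trapped_mono unfolding pt_def by fastforce
  qed
qed

text \<open>The branch \<open>n = 2\<close> has the parabolic fixed point -1, and each use of it
  lowers \<open>1 / (x + 1)\<close> by 1. So \<open>i\<close>, a bound for
  \<open>1 / (x + 1)\<close>, also bounds the number of consecutive such returns, each of which
  takes 3 steps.\<close>

lemma trapped_chain:
  assumes "b - 1 \<le> x" "x < 0" "0 < y" "y \<le> 1" "1 \<le> (x + 1) * real i"
  shows "trapped (1 + 3 * i) (pt x y)"
  using assms
proof (induction i arbitrary: x y)
  case (Suc i)
  have xa: "a \<le> x" using Suc.prems(1) a_succ_lt by simp
  obtain n x' where st: "neg_step x n x'" using neg_step_exists[OF xa Suc.prems(2)] .
  show ?case
  proof (cases "n = 2")
    case False
    then have "3 \<le> n" using neg_step_one[OF st Suc.prems(1)] by simp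
    then have "trapped 1 (pt x y)" using Suc.prems
      by (intro trapped_neg_Dom[OF st] neg_step_far[OF st]) auto
    then show ?thesis using trapped_mono by fastforce
  next
    case True
    define r where "r = 2 - y"
    have "1 / r = - 1 / (y - 2)" using Suc.prems by (simp add: r_def divide_simps)
    then have r: "1 \<le> r" "(Some (y - 2), Some x') = pt x' (1 / r)"
      using Suc.prems Some_eq_pt[of "y - 2" x'] by (auto simp: r_def)
    have x': "x' = - 1 / x - 2" "b - 1 \<le> x'" "x' < b" using st True by (auto simp: neg_step_def)
    have "trapped (1 + 3 * i) (pt x' (1 / r))"
    proof (cases "x' < 0")
      case True
      have "(x' + 1) * (- x) = x + 1" using x' Suc.prems by (simp add: field_simps)
      then have "(- x) * ((x' + 1) * real i) = (x + 1) * real i" by (metis mult.assoc mult.commute)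
      moreover have "- x \<le> (x + 1) * real i" using Suc.prems by (simp add: field_simps)
      ultimately have "(- x) * 1 \<le> (- x) * ((x' + 1) * real i)" by simp
      then have "1 \<le> (x' + 1) * real i" using Suc.prems by (metis mult_le_cancel_left_pos neg_0_less_iff_less)
      moreover have "0 < 1 / r" "1 / r \<le> 1" using r by auto
      ultimately show ?thesis using True x' by (intro Suc.IH)
    next
      case False
      have "trapped 1 (pt x' (1 / r))"
      proof (cases "x' = 0")
        case True then show ?thesis using trapped_zero by (simp add: pt_def)
      next
        case ne: False
        with False have "0 < x'" by simp
        then show ?thesis using x' r by (intro trapped_pos_nonneg) auto
      qed
      then show ?thesis using trapped_mono by fastforce
    qed
    then have "trapped (1 + 3 * i + Suc n) (S (Some y), Some x)"
      using r Suc.prems by (intro trapped_neg[OF st]) (simp add: shift_def True)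
    then show ?thesis using True by (simp add: pt_def)
  qed
qed simp

lemma trapped_small_neg:
  "\<exists>N. \<forall>x y. a \<le> x \<longrightarrow> x < 0 \<longrightarrow> y \<le> 1 \<longrightarrow> trapped N (pt x y)"
proof -
  \<comment> \<open>On \<open>[b - 1, 0)\<close> one has \<open>x + 1 \<ge> b\<close>, so this
    \<open>i\<close> serves every chain there. A point further left enters \<open>[b - 1, b)\<close>
    with its first return.\<close>
  obtain i :: nat where i: "1 / b \<le> real i" using real_arch_simple by blast
  have chain: "trapped (1 + 3 * i) (pt x y)" if "b - 1 \<le> x" "x < 0" "0 \<le> y" "y \<le> 1" for x y
  proof (cases "y = 0")
    case True
    have "a \<le> x" using that a_succ_lt by simp
    then show ?thesis using True that trapped_neg_nonpos[of x y] trapped_mono by fastforce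
  next
    case False
    have "1 \<le> b * real i" using i b_pos by (simp add: field_simps)
    also have "\<dots> \<le> (x + 1) * real i" using that by (intro mult_right_mono) auto
    finally show ?thesis using that False by (intro trapped_chain) auto
  qed
  have "trapped (3 * i + 7) (pt x y)" if x: "a \<le> x" "x < 0" and y: "y \<le> 1" for x y
  proof (cases "y \<le> 0")
    case True
    then show ?thesis using trapped_neg_nonpos[OF x True] trapped_mono by fastforce
  next
    case y0: False
    obtain n x' where st: "neg_step x n x'" using neg_step_exists[OF x] .
    have x': "b - 1 \<le> x'" "x' < b" "1 \<le> n" using st by (auto simp: neg_step_def)
    consider "3 \<le> n" | "n = 2" | "n = 1" using x' by linarith
    then show ?thesis
    proof cases
      case 1
      then have "trapped 1 (pt x y)" using y
        by (intro trapped_neg_Dom[OF st] neg_step_far[OF st]) auto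
      then show ?thesis using trapped_mono by fastforce
    next
      case 2
      have "trapped (1 + 3 * i) (pt x' (1 / (2 - y)))"
      proof (cases "x' < 0")
        case True then show ?thesis using x' y y0 by (intro chain) (auto simp: field_simps)
      next
        case False
        have "trapped 1 (pt x' (1 / (2 - y)))"
          using False x' y trapped_zero trapped_pos_nonneg[of x' "1 / (2 - y)"]
          by (cases "x' = 0") (auto simp: pt_def)
        then show ?thesis using trapped_mono by fastforce
      qed
      then have "trapped (1 + 3 * i + Suc n) (S (Some y), Some x)"
        using 2 y pt_neg[of y n x'] by (intro trapped_neg[OF st]) auto
      then show ?thesis using 2 trapped_mono unfolding pt_def by fastforce
    next
      case 3
      \<comment> \<open>For \<open>y < 1\<close> the new value \<open>1 / (1 - y)\<close> leaves the
        range \<open>y \<le> 1\<close>. But \<open>x' \<ge> 0\<close>, and over positive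
        \<open>x'\<close> a positive \<open>y\<close> is one return away from
        \<open>Dom\<close>.\<close>
      have x'0: "0 \<le> x'" using neg_step_ge[OF st] inv_a_bounds(1) 3 by simp
      have "trapped 1 (Some (y - 1), Some x')"
      proof (cases "x' = 0 \<or> y = 1")
        case True
        then show ?thesis using trapped_zero[of "Some (y - 1)"] trapped_origin[of x'] x' x'0 a_neg by auto
      next
        case False
        have "trapped 1 (pt x' (- 1 / (y - 1)))"
          using False x' x'0 y by (intro trapped_pos_nonneg) (auto simp: divide_simps)
        then show ?thesis using False by (subst Some_eq_pt) auto
      qed
      then have "trapped (1 + Suc n) (S (Some y), Some x)"
        using 3 y y0 by (intro trapped_neg[OF st]) (auto simp: shift_def)
      then show ?thesis using 3 trapped_mono unfolding pt_def by fastforce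
    qed
  qed
  then show ?thesis by blast
qed

lemma trapped_small:
  "\<exists>N. \<forall>x y. a \<le> x \<longrightarrow> x < b \<longrightarrow> \<bar>y\<bar> \<le> 1 \<longrightarrow> trapped N (pt x y)"
proof -
  obtain N where N: "\<And>x y. a \<le> x \<Longrightarrow> x < 0 \<Longrightarrow> y \<le> 1 \<Longrightarrow> trapped N (pt x y)"
    using trapped_small_neg by blast
  have "trapped (N + m + 4) (pt x y)" if "a \<le> x" "x < b" "\<bar>y\<bar> \<le> 1" for x y
  proof -
    consider "x = 0" | "x < 0" | "0 < x" by linarith
    then show ?thesis
    proof cases
      case 1 then show ?thesis using trapped_zero trapped_mono[of 1 "pt x y"] by (simp add: pt_def)
    next
      case 2 then show ?thesis using N[of x y] that trapped_mono by fastforce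
    next
      case 3 then show ?thesis using trapped_small_pos[of x y] that trapped_mono by fastforce
    qed
  qed
  then show ?thesis by blast
qed

text \<open>\<open>1 \<le> \<bar>r\<bar>\<close> means \<open>\<bar>y\<bar> \<le> 1\<close>, and for
  opposite signs the next return is in \<open>Dom\<close>. This leaves the case of equal signs with
  \<open>\<bar>r\<bar> < 1\<close>.\<close>

lemma trapped_easy:
  "\<exists>N. \<forall>x r. a \<le> x \<longrightarrow> x < b \<longrightarrow> 1 \<le> \<bar>r\<bar> \<or> r * x \<le> 0 \<longrightarrow> trapped N (Some r, Some x)"
proof -
  obtain N where N: "\<And>x y. a \<le> x \<Longrightarrow> x < b \<Longrightarrow> \<bar>y\<bar> \<le> 1 \<Longrightarrow> trapped N (pt x y)"
    using trapped_small by blast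
  have "trapped (N + 1) (Some r, Some x)" if x: "a \<le> x" "x < b" and r: "1 \<le> \<bar>r\<bar> \<or> r * x \<le> 0" for x r
  proof (cases "x = 0 \<or> r = 0")
    case True
    then have "trapped 1 (Some r, Some x)" using trapped_zero trapped_origin[OF x] by blast
    then show ?thesis using trapped_mono by fastforce
  next
    case ne: False
    show ?thesis
    proof (cases "1 \<le> \<bar>r\<bar>")
      case True
      then have "\<bar>- 1 / r\<bar> \<le> 1" by (simp add: field_simps)
      then have "trapped N (pt x (- 1 / r))" using N x by blast
      then show ?thesis using ne trapped_mono[of N _ "N + 1"] by (subst Some_eq_pt) auto
    next
      case False
      with r ne consider "0 < x" "r < 0" | "x < 0" "0 < r"
        by (metis linorder_neqE_linordered_idom mult_neg_neg mult_pos_pos not_le)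
      then have "trapped 1 (pt x (- 1 / r))"
      proof cases
        case 1 then show ?thesis using x by (intro trapped_pos_nonneg) (auto simp: divide_simps)
      next
        case 2 then show ?thesis using x by (intro trapped_neg_nonpos) (auto simp: divide_simps)
      qed
      then show ?thesis using ne trapped_mono[of 1 _ "N + 1"] by (subst Some_eq_pt) auto
    qed
  qed
  then show ?thesis by blast
qed

section \<open>Uniform expansion away from the diagonal\<close>

lemma neg_step_contract:
  assumes "neg_step x n x'" shows "(1 + b / 2) * (\<bar>x\<bar> * \<bar>x'\<bar>) \<le> 1"
proof -
  have x': "b - 1 \<le> x'" "x' < b" "1 \<le> real n" "x < 0" using assms by (auto simp: neg_step_def)
  have pos: "0 < x' + real n" using x' b_pos by linarith
  have "(1 + b / 2) * \<bar>x'\<bar> \<le> x' + real n"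
  proof (cases "0 \<le> x'")
    case True
    then have "b / 2 * x' \<le> 1 * 1" using x' b_le b_pos by (intro mult_mono) auto
    then show ?thesis using True x' by (simp add: algebra_simps)
  next
    case False
    then have "n \<noteq> 1" using neg_step_ge[OF assms] inv_a_bounds by auto
    then have n: "2 \<le> real n" using x' by linarith
    \<comment> \<open>The factor \<open>1 + b / 2\<close> comes from here:
      \<open>- x' \<le> 1 - b\<close> together with \<open>n \<ge> 2\<close> leaves room of order
      \<open>b\<close>.\<close>
    have "(2 + b / 2) * (- x') \<le> (2 + b / 2) * (1 - b)" using x' b_pos by (intro mult_left_mono) auto
    also have "\<dots> \<le> 2" using b_pos by (simp add: algebra_simps)
    finally show ?thesis using False n by (simp add: algebra_simps)
  qed
  then have "(1 + b / 2) * \<bar>x'\<bar> / (x' + real n) \<le> 1" using pos by simp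
  moreover have "\<bar>x\<bar> = 1 / (x' + real n)" using neg_step_x[OF assms] pos by simp
  ultimately show ?thesis by simp
qed

lemma pos_step_contract:
  assumes "pos_step x k x'" shows "(1 + b / 2) * (\<bar>x\<bar> * \<bar>x'\<bar>) \<le> 1"
proof -
  have x': "a \<le> x'" "x' < a + 1" "1 \<le> real k" "0 < x" using assms by (auto simp: pos_step_def)
  have pos: "0 < real k - x'" using x' a_neg by linarith
  have "(1 + b / 2) * \<bar>x'\<bar> \<le> real k - x'"
  proof (cases "x' < 0")
    case True
    then have "b / 2 * (- x') \<le> 1 * 1" using x' b_le b_pos a_ge by (intro mult_mono) auto
    then show ?thesis using True x' by (simp add: algebra_simps)
  next
    case False
    have "k \<noteq> 1" using pos_step_lt[OF assms] inv_b_ge False by auto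
    then have k: "2 \<le> real k" using x' by linarith
    have "b / (b + 1) = 1 - 1 / (b + 1)" using b_pos by (simp add: field_simps)
    then have "x' \<le> b / (b + 1)" using x' a_le_inv by simp
    then have "(2 + b / 2) * x' \<le> (2 + b / 2) * (b / (b + 1))" using b_pos by (intro mult_left_mono) auto
    also have "\<dots> \<le> 2"
    proof -
      have "b * b \<le> 1" using b_le b_pos by (simp add: mult_le_one)
      then show ?thesis using b_pos by (simp add: field_simps)
    qed
    finally show ?thesis using False k by (simp add: algebra_simps)
  qed
  then have "(1 + b / 2) * \<bar>x'\<bar> / (real k - x') \<le> 1" using pos by simp
  moreover have "\<bar>x\<bar> = 1 / (real k - x')" using pos_step_x[OF assms] pos by simp
  ultimately show ?thesis by simp
qed

text \<open>One return in bounded time, followed by a delay \<open>M\<close>. If the number of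
  translations exceeds \<open>\<bar>y\<bar>\<close> by at least 2 (by \<open>m + 1\<close> for
  positive \<open>x\<close>), the return is in \<open>Dom\<close>; otherwise
  \<open>separated_bound\<close> limits that number by \<open>1 / d\<close> plus a constant. The
  premise \<open>nxt\<close> asks for \<open>M\<close> in either situation of the image: easy, or
  with the growth from \<open>separation_grows\<close>.\<close>

lemma trapped_transition:
  assumes d: "0 < d" and x: "a \<le> x" "x < b" and r: "\<bar>r\<bar> < 1" "0 < r * x" "d \<le> \<bar>r - x\<bar>"
    and nxt: "\<And>x' r'. a \<le> x' \<Longrightarrow> x' < b \<Longrightarrow> (1 \<le> \<bar>r'\<bar> \<or> r' * x' \<le> 0) \<or>
      ((r - x)\<^sup>2 \<le> \<bar>x\<bar> \<and> d \<le> \<bar>r' - x'\<bar> \<and>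
       (\<forall>c. \<bar>x\<bar> < (r - x)\<^sup>2 * ((1 + b / 2) * c) \<longrightarrow> \<bar>x'\<bar> < (r' - x')\<^sup>2 * c)) \<Longrightarrow>
      trapped M (Some r', Some x')"
  shows "trapped (M + nat \<lceil>1 / d\<rceil> + m + 4) (Some r, Some x)"
proof -
  have bd: "\<bar>z\<bar> \<le> 1" if "a \<le> z" "z < b" for z using that a_ge b_le by auto
  have ne: "r \<noteq> 0" "x \<noteq> 0" using r by auto
  define y where "y = - 1 / r"
  have pt: "(Some r, Some x) = pt x y" using ne Some_eq_pt by (simp add: y_def)
  have Sr: "S (Some r) = Some y" using ne by (simp add: y_def)
  have q: "0 < 1 + b / 2" using b_pos by simp
  have ceil: "1 / d \<le> real (nat \<lceil>1 / d\<rceil>)" by linarith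
  have trapped_next: "trapped M (Some r', Some x')"
    if "a \<le> x'" "x' < b" "r' - x' = - 1 / r + 1 / x" "(1 + b / 2) * (\<bar>x\<bar> * \<bar>x'\<bar>) \<le> 1" for x' r'
  proof (cases "1 \<le> \<bar>r'\<bar> \<or> r' * x' \<le> 0")
    case True
    then show ?thesis using nxt that by blast
  next
    case False
    then have "\<bar>r'\<bar> < 1" "0 < r' * x'" by auto
    note g = separation_grows[OF ne(2,1) r(1) bd[OF x] this(1) bd[OF that(1,2)] this(2) that(3) q that(4)]
    show ?thesis using g(1,2) r(3) by (intro nxt that(1,2) disjI2 conjI allI impI g(3)) auto
  qed
  have "x < 0 \<or> 0 < x" using ne by auto
  then show ?thesis
  proof
    assume x0: "x < 0"
    then have r0: "r < 0" using r by (simp add: zero_less_mult_iff)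
    obtain n x' where st: "neg_step x n x'" using neg_step_exists[OF x(1) x0] .
    have x': "b - 1 \<le> x'" "x' < b" "a \<le> x'" "x' = - 1 / x - real n"
      using st a_succ_lt by (auto simp: neg_step_def)
    show ?thesis
    proof (cases "2 \<le> real n - y")
      case True
      then have "trapped 1 (pt x y)" by (intro trapped_neg_Dom[OF st] neg_step_far[OF st]) auto
      then show ?thesis unfolding pt using trapped_mono by fastforce
    next
      case False
      have "real n - 2 \<le> 1 / d"
      proof (rule separated_bound[OF d])
        show "0 < - x" "0 < y" "real n - 2 < y" using x0 r0 False by (auto simp: y_def divide_neg_neg)
        have "\<bar>r - x\<bar> * y = \<bar>(r - x) * y\<bar>" using \<open>0 < y\<close> by (simp add: abs_mult)
        also have "(r - x) * y = - (1 - (- x) * y)" using ne by (simp add: y_def field_simps)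
        finally have e: "\<bar>r - x\<bar> * y = \<bar>1 - (- x) * y\<bar>" by simp
        show "d * y \<le> \<bar>1 - (- x) * y\<bar>" unfolding e[symmetric] using r \<open>0 < y\<close> by simp
        have pos: "0 < x' + real n" and mx: "- x = 1 / (x' + real n)" using x' x0 by auto
        show "- x * (real n - 2) \<le> 1" unfolding mx using pos x'(1) b_pos by simp
      qed
      moreover have "trapped M (Some (y - real n), Some x')"
        using x' neg_step_contract[OF st] by (intro trapped_next) (auto simp: y_def)
      then have "trapped (M + Suc n) (Some r, Some x)"
        by (intro trapped_neg[OF st]) (simp add: Sr shift_def del: S.simps)
      ultimately show ?thesis using ceil by (elim trapped_mono) linarith
    qed
  next
    assume x0: "0 < x"
    then have r0: "0 < r" using r by (simp add: zero_less_mult_iff)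
    obtain k x' where st: "pos_step x k x'" using pos_step_exists[OF x0 x(2)] .
    have x': "x' < a + 1" "x' < b" "a \<le> x'" "x' = - 1 / x + real k"
      using st a_succ_lt by (auto simp: pos_step_def)
    show ?thesis
    proof (cases "real m + 1 \<le> y + real k")
      case True
      then have "trapped 1 (pt x y)" by (intro trapped_pos_Dom[OF st] pos_step_far[OF st]) auto
      then show ?thesis unfolding pt using trapped_mono by fastforce
    next
      case False
      have "real k - real m - 1 \<le> 1 / d"
      proof (rule separated_bound[OF d])
        show "0 < x" "0 < - y" "real k - real m - 1 < - y" using x0 r0 False by (auto simp: y_def)
        have "\<bar>r - x\<bar> * (- y) = \<bar>(r - x) * (- y)\<bar>" using \<open>0 < - y\<close> by (simp add: abs_mult)
        also have "(r - x) * (- y) = 1 - x * (- y)" using ne by (simp add: y_def field_simps)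
        finally show "d * (- y) \<le> \<bar>1 - x * (- y)\<bar>" using r \<open>0 < - y\<close> by (metis mult_le_cancel_right_pos)
        have "0 < real k - x'" "x = 1 / (real k - x')" using x' x0 by auto
        then show "x * (real k - real m - 1) \<le> 1" using x'(1) a_neg by simp
      qed
      moreover have "trapped M (Some (y + real k), Some x')"
        using x' pos_step_contract[OF st] by (intro trapped_next) (auto simp: y_def)
      then have "trapped (M + Suc k) (Some r, Some x)"
        by (intro trapped_pos[OF st]) (simp add: Sr shift_def del: S.simps)
      ultimately show ?thesis using ceil by (elim trapped_mono) linarith
    qed
  qed
qed

text \<open>Each induction step spends one factor \<open>1 + b / 2\<close>. At \<open>i = 0\<close>
  the hypothesis \<open>\<bar>x\<bar> < (r - x)\<^sup>2\<close> contradicts the bound that holds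
  when the image is not easy, so the image is easy.\<close>

lemma trapped_separated_step:
  assumes "0 < d"
  shows "\<exists>N. \<forall>x r. a \<le> x \<longrightarrow> x < b \<longrightarrow> d \<le> \<bar>r - x\<bar> \<longrightarrow> \<bar>x\<bar> < (r - x)\<^sup>2 * (1 + b / 2) ^ i
    \<longrightarrow> trapped N (Some r, Some x)"
proof -
  obtain E where E: "\<And>x r. a \<le> x \<Longrightarrow> x < b \<Longrightarrow> 1 \<le> \<bar>r\<bar> \<or> r * x \<le> 0 \<Longrightarrow> trapped E (Some r, Some x)"
    using trapped_easy by blast
  show ?thesis
  proof (induction i)
    case base: 0
    have "trapped (E + nat \<lceil>1 / d\<rceil> + m + 4) (Some r, Some x)"
      if x: "a \<le> x" "x < b" and r: "d \<le> \<bar>r - x\<bar>" "\<bar>x\<bar> < (r - x)\<^sup>2 * (1 + b / 2) ^ 0" for x r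
    proof (cases "1 \<le> \<bar>r\<bar> \<or> r * x \<le> 0")
      case True
      then show ?thesis using E x trapped_mono[of E] by simp
    next
      case False
      then have *: "\<bar>r\<bar> < 1" "0 < r * x" by auto
      show ?thesis
        by (rule trapped_transition[OF assms x * r(1)]) (use E r(2) in auto)
    qed
    then show ?case by blast
  next
    case (Suc i)
    then obtain N where N: "\<And>x r. a \<le> x \<Longrightarrow> x < b \<Longrightarrow> d \<le> \<bar>r - x\<bar> \<Longrightarrow> \<bar>x\<bar> < (r - x)\<^sup>2 * (1 + b / 2) ^ i
      \<Longrightarrow> trapped N (Some r, Some x)" by blast
    have "trapped (E + N + nat \<lceil>1 / d\<rceil> + m + 4) (Some r, Some x)"
      if x: "a \<le> x" "x < b" and r: "d \<le> \<bar>r - x\<bar>" "\<bar>x\<bar> < (r - x)\<^sup>2 * (1 + b / 2) ^ Suc i" for x r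
    proof (cases "1 \<le> \<bar>r\<bar> \<or> r * x \<le> 0")
      case True
      then show ?thesis using E x trapped_mono[of E] by simp
    next
      case False
      then have *: "\<bar>r\<bar> < 1" "0 < r * x" by auto
      show ?thesis
      proof (rule trapped_transition[OF assms x * r(1)])
        fix x' r'
        assume x': "a \<le> x'" "x' < b" and "(1 \<le> \<bar>r'\<bar> \<or> r' * x' \<le> 0) \<or>
          ((r - x)\<^sup>2 \<le> \<bar>x\<bar> \<and> d \<le> \<bar>r' - x'\<bar> \<and>
           (\<forall>c. \<bar>x\<bar> < (r - x)\<^sup>2 * ((1 + b / 2) * c) \<longrightarrow> \<bar>x'\<bar> < (r' - x')\<^sup>2 * c))"
        then consider "1 \<le> \<bar>r'\<bar> \<or> r' * x' \<le> 0" | "d \<le> \<bar>r' - x'\<bar>" "\<bar>x'\<bar> < (r' - x')\<^sup>2 * (1 + b / 2) ^ i"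
          using r(2) by (auto simp del: zero_le_mult_iff mult_le_0_iff)
        then show "trapped (E + N) (Some r', Some x')"
          using E[OF x'] N[OF x'] trapped_mono[of E _ "E + N"] trapped_mono[of N _ "E + N"] by cases auto
      qed
    qed
    then show ?case by blast
  qed
qed

lemma trapped_separated:
  assumes "0 < d"
  shows "\<exists>N. \<forall>x r. a \<le> x \<longrightarrow> x < b \<longrightarrow> d \<le> \<bar>r - x\<bar> \<longrightarrow> trapped N (Some r, Some x)"
proof -
  obtain i where i: "1 / d\<^sup>2 < (1 + b / 2) ^ i"
    using real_arch_pow[of "1 + b / 2"] b_pos by auto
  then have "1 < d\<^sup>2 * (1 + b / 2) ^ i" using assms by (simp add: field_simps)
  moreover have "d\<^sup>2 \<le> (r - x)\<^sup>2" if "d \<le> \<bar>r - x\<bar>" for r x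
    using power_mono[OF that, of 2] assms by simp
  moreover have "0 \<le> (1 + b / 2) ^ i" using b_pos by simp
  ultimately have "1 < (r - x)\<^sup>2 * (1 + b / 2) ^ i" if "d \<le> \<bar>r - x\<bar>" for r x
    using that mult_right_mono less_le_trans by blast
  moreover have "\<bar>x\<bar> \<le> 1" if "a \<le> x" "x < b" for x using that a_ge b_le by auto
  ultimately show ?thesis using trapped_separated_step[OF assms, of i] by (meson le_less_trans)
qed

lemma trapped_infinity:
  assumes "a \<le> x" "x < b" shows "trapped 1 (None, Some x)"
proof -
  have "trapped 1 (pt x 0)"
    using assms trapped_neg_nonpos[of x 0] trapped_pos_nonneg[of x 0] trapped_zero[of None]
    by (cases "x = 0"; cases "x < 0") (auto simp: pt_def)
  then show ?thesis by (simp add: pt_def)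
qed

section \<open>Preimages in the domain\<close>

lemma neg_step_intro:
  assumes "b - 1 \<le> x'" "x' < b" "1 \<le> n" "- 1 / a \<le> x' + real n"
  shows "neg_step (- 1 / (x' + real n)) n x'"
proof -
  have "0 < x' + real n" using assms(4) inv_a_bounds(1) by linarith
  then show ?thesis using assms a_neg by (auto simp: neg_step_def field_simps)
qed

lemma pos_step_intro:
  assumes "a \<le> x'" "x' < a + 1" "1 \<le> k" "1 / b < real k - x'"
  shows "pos_step (1 / (real k - x')) k x'"
proof -
  have "0 < real k - x'" using assms(4) inv_b_ge by linarith
  then show ?thesis using assms b_pos by (auto simp: pos_step_def field_simps)
qed

text \<open>In the coordinate \<open>1 / (x + 1)\<close> the point \<open>- 1 / (X + 1)\<close>
  becomes \<open>1 + 1 / X\<close>, so the threshold \<open>1 / b - real p\<close> drops by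
  1.\<close>

lemma t_add_1_less: assumes "0 < X" "real p \<le> real m - 1"
  shows "- 1 / (X + 1) < t p \<longleftrightarrow> X * (1 / b - real p - 1) < 1"
proof -
  have "- 1 / (X + 1) + 1 = X / (X + 1)" using assms(1) by (simp add: field_simps)
  moreover have "0 < X / (X + 1)" using assms(1) by simp
  ultimately have "- 1 / (X + 1) < t p \<longleftrightarrow> X / (X + 1) * (1 / b - real p) < 1"
    using assms(2) by (subst t_less_iff) auto
  also have "\<dots> \<longleftrightarrow> X * (1 / b - real p) < X + 1" using assms(1) by (simp add: pos_divide_less_eq)
  finally show ?thesis by (simp add: algebra_simps)
qed

lemma Dom_back_plus:
  assumes "b \<le> X" "0 < f" "f < 1" "1 / (real m + 1) \<le> f"
    and "\<And>p. p < m \<Longrightarrow> X * (1 / b - real p - 1) < 1 \<Longrightarrow> 1 / (real p + 1) \<le> f"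
  shows "(- 1 / (X + 1), 1 - f) \<in> Dom"
proof -
  have X: "0 < X" using assms(1) b_pos by simp
  \<comment> \<open>The instance \<open>p = 0\<close> of the last assumption would give
    \<open>f \<ge> 1\<close>. Hence its premise fails, which says
    \<open>t 0 \<le> - 1 / (X + 1)\<close>.\<close>
  have "b - 1 \<le> - 1 / (X + 1)"
    using assms(5)[of 0] assms(3) m_ge t_add_1_less[OF X, of 0] t_0 by fastforce
  moreover have "- 1 / (X + 1) < b" using X b_pos by (smt (verit) divide_neg_pos)
  moreover have "1 - f \<le> real p / (real p + 1)" if "p \<in> {1..<m}" "- 1 / (X + 1) < t p" for p
  proof -
    have "X * (1 / b - real p - 1) < 1" using that X t_add_1_less[of X p] by (auto simp: of_nat_diff)
    then have "1 / (real p + 1) \<le> f" using assms(5) that by auto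
    then show ?thesis by (subst (asm) compl_frac_le) auto
  qed
  moreover have "1 - f \<le> real m / (real m + 1)"
    using assms(4) by (subst (asm) compl_frac_le) auto
  ultimately show ?thesis using assms(2,3) by (auto simp: Dom_def Pplus_def)
qed

lemma Dom_back_minus:
  assumes "a \<le> x" "x < a + 1" "0 < f" "f \<le> 1 / real m" "m - 1 / b \<le> x \<Longrightarrow> f \<le> 1 / (real m + 1)"
  shows "(x, - f) \<in> Dom"
  using assms by (auto simp: Dom_def Pminus_def)

text \<open>With \<open>f\<close> the fractional part of \<open>1 / y'\<close>, the preimage has \<open>y = - f\<close> or \<open>y = 1 - f\<close>; for
  \<open>1 / (m + 1) < f \<le> 1 / m\<close> the position of \<open>x\<close> decides which of the two lies in \<open>Dom\<close>.\<close>

lemma Dom_predecessor_pos: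
  assumes D: "(x', y') \<in> Dom" and y': "0 < y'" "y' \<notin> \<rat>"
  shows "\<exists>x y n. (x, y) \<in> Dom \<and> neg_step x n x' \<and> y = real n - 1 / y'"
proof -
  have P: "b - 1 \<le> x'" "x' < b" "y' \<le> 1" 
      "\<And>p. 1 \<le> p \<Longrightarrow> p < m \<Longrightarrow> x' < t p \<Longrightarrow> y' \<le> real p / (real p + 1)"
      "x' < - 1 / a - 1 \<Longrightarrow> y' \<le> real m / (real m + 1)"
    using D y' by (auto simp: Dom_def Pplus_def Pminus_def)
  have v1: "1 \<le> 1 / y'" using P(3) y' by simp
  define N where "N = nat \<lfloor>1 / y'\<rfloor>"
  define f where "f = 1 / y' - real N"
  define X where "X = x' + real N"
  have N1: "1 \<le> N" using v1 unfolding N_def by linarith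
  have "real N = of_int \<lfloor>1 / y'\<rfloor>" using v1 unfolding N_def by linarith
  then have f01: "0 \<le> f" "f < 1" unfolding f_def by linarith+
  have "f \<noteq> 0"
  proof
    assume "f = 0"
    then have "y' = 1 / real N" using y' N1 by (simp add: f_def field_simps)
    then show False using y'(2) by simp
  qed
  with f01 have f0: "0 < f" by simp
  have Xb: "b \<le> X" using P(1) N1 by (simp add: X_def)
  have X0: "0 < X" using Xb b_pos by simp
  have plus: ?thesis if "(- 1 / (X + 1), 1 - f) \<in> Dom"
  proof -
    have "neg_step (- 1 / (x' + real (N + 1))) (N + 1) x'"
      using P(1,2) N1 inv_a_bounds(2) by (intro neg_step_intro) auto
    then show ?thesis using that
      by (intro exI[of _ "- 1 / (X + 1)"] exI[of _ "1 - f"] exI[of _ "N + 1"]) (simp add: X_def f_def ac_simps)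
  qed
  have m_inv: "1 / (real m + 1) \<le> 1 / real m" using m_ge by (simp add: field_simps)
  \<comment> \<open>\<open>- 1 / a \<le> X\<close> means that the candidate \<open>- 1 / X\<close>
    is at least \<open>a\<close>, so that \<open>n = N\<close> is admissible;
    \<open>n = N + 1\<close> always is.\<close>
  show ?thesis
  proof (cases "- 1 / a \<le> X")
    case True
    have st: "neg_step (- 1 / X) N x'"
      using P(1,2) N1 True unfolding X_def by (intro neg_step_intro) auto
    have minus: ?thesis if "(- 1 / X, - f) \<in> Dom"
      using that st by (intro exI[of _ "- 1 / X"] exI[of _ "- f"] exI[of _ N]) (simp add: f_def)
    show ?thesis
    proof (cases "f \<le> 1 / real m \<and> (m - 1 / b \<le> - 1 / X \<longrightarrow> f \<le> 1 / (real m + 1))")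
      case True
      have "a \<le> - 1 / X" "- 1 / X < 0" using st by (auto simp: neg_step_def)
      then have "a \<le> - 1 / X" "- 1 / X < a + 1" using a_ge by linarith+
      then show ?thesis using True f0 by (intro minus Dom_back_minus) auto
    next
      case False
      then have fm: "1 / (real m + 1) < f" and alt: "1 / real m < f \<or> m - 1 / b \<le> - 1 / X"
        using m_inv by auto
      \<comment> \<open>The only bound that can be active at \<open>- 1 / (X + 1)\<close> is the one
        for \<open>p = m - 1\<close>, and then \<open>f > 1 / m\<close>.\<close>
      have "1 / (real p + 1) \<le> f" if p: "p < m" "X * (1 / b - real p - 1) < 1" for p
      proof -
        have "\<not> (m - 1 / b \<le> - 1 / X)"
        proof
          assume "m - 1 / b \<le> - 1 / X"
          then have "X * (1 / X) \<le> X * (1 / b - m)" using X0 by (intro mult_left_mono) auto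
          also have "\<dots> \<le> X * (1 / b - real p - 1)" using X0 p by (intro mult_left_mono) auto
          finally show False using p(2) X0 by simp
        qed
        with alt have f1m: "1 / real m < f" by simp
        have "m = p + 1"
        proof (rule ccontr)
          assume "m \<noteq> p + 1"
          then have "real p + 2 \<le> real m" using p by linarith
          then have ge: "- a \<le> 1 / b - real p - 1" using hi by linarith
          have "1 = (- 1 / a) * (- a)" using a_neg by simp
          also have "\<dots> \<le> X * (1 / b - real p - 1)"
            using ge \<open>- 1 / a \<le> X\<close> X0 a_neg by (intro mult_mono) auto
          finally show False using p(2) by simp
        qed
        then show ?thesis using f1m by (simp add: add.commute)
      qed
      then show ?thesis using Xb f0 f01 fm by (intro plus Dom_back_plus) auto
    qed
  next
    case False
    \<comment> \<open>\<open>N \<ge> 2\<close> would give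
      \<open>X \<ge> b + 1 \<ge> - 1 / a\<close>. So the preimage has \<open>n = 2\<close>, and the
      upper bounds on \<open>y'\<close> from \<open>Pplus\<close> become lower bounds on
      \<open>f = 1 / y' - 1\<close>.\<close>
    have N: "N = 1"
    proof (rule ccontr)
      assume "N \<noteq> 1"
      then have "2 \<le> real N" using N1 by linarith
      then show False using False P(1) inv_a_bounds(2) by (simp add: X_def)
    qed
    have f: "1 / real q \<le> f" if "y' \<le> real q / (real q + 1)" "1 \<le> q" for q
    proof -
      have "1 / (real q / (real q + 1)) \<le> 1 / y'" using that y' by (intro divide_left_mono mult_pos_pos) auto
      then have "1 + 1 / real q \<le> 1 / y'" using that by (simp add: add_divide_distrib)
      then show ?thesis by (simp add: f_def N)
    qed
    have fm: "1 / real m \<le> f" using False P(5) m_ge by (intro f) (auto simp: X_def N)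
    have "1 / (real p + 1) \<le> f" if p: "p < m" "X * (1 / b - real p - 1) < 1" for p
    proof (cases "p + 1 = m")
      case True
      then show ?thesis using fm by (auto simp: add.commute)
    next
      case False
      have "0 < x' + 1" "X = x' + 1" using X0 by (auto simp: X_def N)
      then have "x' < t (p + 1)" using p False by (subst t_less_iff) (auto simp: algebra_simps)
      then show ?thesis using f[of "p + 1"] P(4)[of "p + 1"] p False by (auto simp: add.commute)
    qed
    then show ?thesis using Xb f0 f01 fm m_inv by (intro plus Dom_back_plus) auto
  qed
qed

text \<open>With \<open>f\<close> the fractional part of \<open>- 1 / y'\<close>, the candidates are
  \<open>(1 / Z, f)\<close> for \<open>k = N\<close> and \<open>(1 / (Z + 1), f - 1)\<close> for
  \<open>k = N + 1\<close>. For \<open>f \<le> (m - 1) / m\<close> the first one works. For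
  \<open>f \<ge> m / (m + 1)\<close> it works over the column of height 1; where
  \<open>1 / Z < - 1 / a - 1\<close> this column is missed, but that inequality is equivalent to
  \<open>1 / (Z + 1) < a + 1\<close>, and the second one works. In between, the position of
  \<open>1 / (Z + 1)\<close> relative to \<open>m - 1 / b\<close> decides.\<close>

lemma Dom_predecessor_neg:
  assumes D: "(x', y') \<in> Dom" and y': "y' < 0" "y' \<notin> \<rat>"
  shows "\<exists>x y k. (x, y) \<in> Dom \<and> pos_step x k x' \<and> y = - 1 / y' - real k"
proof -
  have P: "a \<le> x'" "x' < a + 1" "- 1 / real m \<le> y'" "m - 1 / b \<le> x' \<Longrightarrow> - 1 / (real m + 1) \<le> y'"
    using D y' by (auto simp: Dom_def Pplus_def Pminus_def)
  define v where "v = - 1 / y'"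
  have vge: "q \<le> v" if "- 1 / q \<le> y'" "0 < q" for q
    using that y' by (simp add: v_def field_simps)
  have vm: "real m \<le> v" using P(3) m_ge by (intro vge) auto
  define N where "N = nat \<lfloor>v\<rfloor>"
  define f where "f = v - real N"
  define Z where "Z = real N - x'"
  have N: "real N = of_int \<lfloor>v\<rfloor>" using vm by (simp add: N_def)
  then have f01: "0 \<le> f" "f < 1" unfolding f_def by linarith+
  have Nm: "m \<le> N" using vm unfolding N_def by linarith
  have "f \<noteq> 0"
  proof
    assume "f = 0"
    then have "y' = - 1 / real N" using y' Nm m_ge by (simp add: f_def v_def field_simps)
    then show False using y'(2) by simp
  qed
  with f01 have f0: "0 < f" by simp
  have ZB: "1 / b < Z"
  proof (cases "m - 1 / b \<le> x'")
    case True
    then have "real m + 1 \<le> v" using P(4) by (intro vge) auto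
    then have "m + 1 \<le> N" unfolding N_def by linarith
    then have "real m + 1 \<le> real N" by linarith
    then show ?thesis using P(2) lo by (simp add: Z_def)
  next
    case False
    have "real m \<le> real N" using Nm by simp
    then show ?thesis using False by (simp add: Z_def)
  qed
  have Z0: "0 < Z" using ZB inv_b_ge by linarith
  have N1: "1 \<le> N" using Nm m_ge by simp
  have st1: "pos_step (1 / Z) N x'" using P ZB N1 unfolding Z_def by (intro pos_step_intro) auto
  have "pos_step (1 / (real (N + 1) - x')) (N + 1) x'"
    using P ZB unfolding Z_def by (intro pos_step_intro) auto
  then have st2: "pos_step (1 / (Z + 1)) (N + 1) x'" by (simp add: Z_def algebra_simps)
  have plus: ?thesis if "(1 / Z, f) \<in> Dom"
    using that st1 by (intro exI[of _ "1 / Z"] exI[of _ f] exI[of _ N]) (simp add: f_def v_def)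
  have minus: ?thesis if "(1 / (Z + 1), - (1 - f)) \<in> Dom"
    using that st2 by (intro exI[of _ "1 / (Z + 1)"] exI[of _ "- (1 - f)"] exI[of _ "N + 1"]) (simp add: f_def v_def)
  have x1: "0 < 1 / Z" "1 / Z < b" using st1 by (auto simp: pos_step_def)
  have x2: "0 < 1 / (Z + 1)" using Z0 by simp
  have plusI: "(1 / Z, f) \<in> Dom"
    if fm: "f \<le> real m / (real m + 1)"
      and p: "\<And>p. 1 \<le> p \<Longrightarrow> p < m \<Longrightarrow> (Z + 1) * (1 / b - real p) < Z \<Longrightarrow> f \<le> real p / (real p + 1)"
  proof -
    have "f \<le> real p / (real p + 1)" if "p \<in> {1..<m}" "1 / Z < t p" for p
    proof -
      have "0 < 1 / Z + 1" using x1 by linarith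
      moreover have "real p \<le> real m - 1" using that by auto
      ultimately have "(1 / Z + 1) * (1 / b - real p) < 1" using that(2) t_less_iff by blast
      moreover have "(1 / Z + 1) * (1 / b - real p) = (Z + 1) * (1 / b - real p) / Z"
        using Z0 by (simp add: field_simps)
      ultimately have "(Z + 1) * (1 / b - real p) < Z" using Z0 by (simp add: pos_divide_less_eq)
      then show ?thesis using p that by auto
    qed
    moreover have "b - 1 \<le> 1 / Z" using x1 b_le by linarith
    ultimately show ?thesis using f0 f01 fm x1 by (simp add: Dom_def Pplus_def)
  qed
  have cm: "1 - f \<le> 1 / real m \<longleftrightarrow> (real m - 1) / real m \<le> f"
      "1 - f \<le> 1 / (real m + 1) \<longleftrightarrow> real m / (real m + 1) \<le> f"
    using m_ge by (auto simp: field_simps)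
  have mm: "(real m - 1) / real m \<le> real m / (real m + 1)" using m_ge by (simp add: field_simps)
  consider (low) "f \<le> (real m - 1) / real m" | (high) "real m / (real m + 1) \<le> f"
    | (mid) "(real m - 1) / real m < f" "f < real m / (real m + 1)" by linarith
  then show ?thesis
  proof cases
    case low
    show ?thesis
    proof (intro plus plusI)
      show "f \<le> real m / (real m + 1)" using low mm by simp
      fix p assume p: "1 \<le> p" "p < m" "(Z + 1) * (1 / b - real p) < Z"
      have "m = p + 1"
      proof (rule ccontr)
        assume "m \<noteq> p + 1"
        then have "real p + 2 \<le> real m" using p by linarith
        then have "1 \<le> 1 / b - real p" using hi a_neg by linarith
        then have "(Z + 1) * 1 \<le> (Z + 1) * (1 / b - real p)" using Z0 by (intro mult_left_mono) auto
        then show False using p by simp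
      qed
      then show "f \<le> real p / (real p + 1)" using low by (simp add: add.commute)
    qed
  next
    case high
    show ?thesis
    proof (cases "- 1 / a - 1 \<le> 1 / Z")
      case True
      then show ?thesis using x1 f0 f01 by (intro plus Dom_plus_right) auto
    next
      case False
      then have "- a < (1 + a) * Z" using Z0 a_neg by (simp add: field_simps)
      then have "1 < (Z + 1) * (a + 1)" by (simp add: algebra_simps)
      then have "1 / (Z + 1) < a + 1" using Z0 by (simp add: pos_divide_less_eq mult.commute)
      moreover have "a \<le> 1 / (Z + 1)" using x2 a_neg by linarith
      moreover have "1 - f \<le> 1 / (real m + 1)" using high cm by simp
      moreover have "1 - f \<le> 1 / real m" using high mm cm by simp
      ultimately show ?thesis using f01 by (intro minus Dom_back_minus) auto
    qed
  next
    case mid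
    show ?thesis
    proof (cases "1 / (Z + 1) < m - 1 / b")
      case True
      moreover have "a \<le> 1 / (Z + 1)" using x2 a_neg by linarith
      moreover have "1 - f \<le> 1 / real m" using mid cm by simp
      ultimately show ?thesis using f01 hi by (intro minus Dom_back_minus) auto
    next
      case False
      then have le: "(Z + 1) * (m - 1 / b) \<le> 1" using Z0 by (simp add: not_less pos_le_divide_eq mult.commute)
      have "\<not> (Z + 1) * (1 / b - real p) < Z" if "p < m" for p
      proof -
        have "Z \<le> (Z + 1) * (1 / b - m + 1)" using le by (simp add: algebra_simps)
        also have "\<dots> \<le> (Z + 1) * (1 / b - real p)" using that Z0 by (intro mult_left_mono) auto
        finally show ?thesis by simp
      qed
      then show ?thesis using mid by (intro plus plusI) auto
    qed
  qed
qed

section \<open>Comparison with the attractor\<close>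

lemma strip_None: "\<not> strip ((F a b ^^ k) (u, None))"
proof -
  have "snd ((F a b ^^ k) (u, None)) = None"
  proof (induction k)
    case (Suc k)
    obtain v where "(F a b ^^ k) (u, None) = (v, None)" using Suc by (metis prod.collapse)
    then show ?case by (simp add: F_def shift_def)
  qed simp
  then show ?thesis by (simp add: strip_def)
qed

text \<open>\<open>j\<close> is the first entry time. The final alternatives record the side of
  entry: from above the orbit lands over the base of \<open>Pplus\<close>, from below over that of
  \<open>Pminus\<close>.\<close>

lemma enter_strip:
  obtains j s w' where "(F a b ^^ j) (u, Some w) = (shift s u, Some w')" "w' = w + s"
    "\<bar>s\<bar> = real j" "\<bar>w\<bar> - 1 \<le> real j" "real j \<le> \<bar>w\<bar> + 2" "\<forall>i<j. \<not> strip ((F a b ^^ i) (u, Some w))"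
    "s \<le> 0 \<and> b - 1 \<le> w' \<and> w' < b \<or> 0 \<le> s \<and> a \<le> w' \<and> w' < a + 1 \<or> s = 0 \<and> a \<le> w' \<and> w' < b"
proof -
  consider "b \<le> w" | "w < a" | "a \<le> w" "w < b" by linarith
  then show thesis
  proof cases
    case 1
    define n where "n = nat (\<lfloor>w - b\<rfloor> + 1)"
    have n: "real n = of_int \<lfloor>w - b\<rfloor> + 1" using 1 by (simp add: n_def)
    have ge: "b \<le> w - real i" if "i < n" for i
    proof -
      have "real i + 1 \<le> real n" using that by linarith
      then show ?thesis using n by linarith
    qed
    have bd: "b - 1 \<le> w - real n" "w - real n < b" using n by linarith+
    show ?thesis
    proof (rule that[of n "- real n"])
      show "\<forall>i<n. \<not> strip ((F a b ^^ i) (u, Some w))"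
      proof (intro allI impI)
        fix i assume that: "i < n"
        have "(F a b ^^ i) (u, Some w) = (shift (- real i) u, Some (w - real i))"
          using ge that by (intro F_down) auto
        then show "\<not> strip ((F a b ^^ i) (u, Some w))" using ge[OF that] by (simp only: strip_def snd_conv option.inject) auto
      qed
      show "real n \<le> \<bar>w\<bar> + 2" using bd b_pos by linarith
      show "\<bar>w\<bar> - 1 \<le> real n" using bd b_le 1 b_pos by linarith
    qed (use F_down[of n w u] ge bd in auto)
  next
    case 2
    define n where "n = nat (- \<lfloor>w - a\<rfloor>)"
    have n: "real n = - of_int \<lfloor>w - a\<rfloor>" using 2 by (simp add: n_def)
    have ge: "w + real i < a" if "i < n" for i
    proof -
      have "real i + 1 \<le> real n" using that by linarith
      then show ?thesis using n by linarith
    qed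
    have bd: "a \<le> w + real n" "w + real n < a + 1" using n by linarith+
    show ?thesis
    proof (rule that[of n "real n"])
      show "\<forall>i<n. \<not> strip ((F a b ^^ i) (u, Some w))"
      proof (intro allI impI)
        fix i assume that: "i < n"
        have "(F a b ^^ i) (u, Some w) = (shift (real i) u, Some (w + real i))"
          using ge that by (intro F_up) auto
        then show "\<not> strip ((F a b ^^ i) (u, Some w))" using ge[OF that] by (simp only: strip_def snd_conv option.inject) auto
      qed
      show "real n \<le> \<bar>w\<bar> + 2" using bd a_neg by linarith
      show "\<bar>w\<bar> - 1 \<le> real n" using bd 2 a_neg a_ge by linarith
    qed (use F_up[of n w u] ge bd in auto)
  next
    case 3
    then show ?thesis using a_ge b_le
      by (intro that[of 0 0]) (auto simp: shift_def option.map_ident)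
  qed
qed

text \<open>Translations preserve \<open>r - w\<close>, so the separation survives until the strip
  is reached, and \<open>Y\<close> bounds the time needed for that.\<close>

lemma trapped_separated_all:
  assumes "0 < d"
  shows "\<exists>N. \<forall>u w. \<bar>w\<bar> \<le> Y \<longrightarrow> (\<forall>r. u = Some r \<longrightarrow> d \<le> \<bar>r - w\<bar>) \<longrightarrow> trapped N (u, Some w)"
proof -
  obtain N where N: "\<And>x r. a \<le> x \<Longrightarrow> x < b \<Longrightarrow> d \<le> \<bar>r - x\<bar> \<Longrightarrow> trapped N (Some r, Some x)"
    using trapped_separated[OF assms] by blast
  have "trapped (N + 1 + nat \<lceil>Y + 2\<rceil>) (u, Some w)"
    if w: "\<bar>w\<bar> \<le> Y" and sep: "\<And>r. u = Some r \<Longrightarrow> d \<le> \<bar>r - w\<bar>" for u w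
  proof -
    obtain j s w' where j: "(F a b ^^ j) (u, Some w) = (shift s u, Some w')" "w' = w + s"
      "\<bar>s\<bar> = real j" "\<bar>w\<bar> - 1 \<le> real j" "real j \<le> \<bar>w\<bar> + 2"
      "\<forall>i<j. \<not> strip ((F a b ^^ i) (u, Some w))"
      "s \<le> 0 \<and> b - 1 \<le> w' \<and> w' < b \<or> 0 \<le> s \<and> a \<le> w' \<and> w' < a + 1 \<or> s = 0 \<and> a \<le> w' \<and> w' < b"
      by (rule enter_strip[of u w])
    have w': "a \<le> w'" "w' < b" using j(7) a_succ_lt by auto
    have "trapped (N + 1) (shift s u, Some w')"
    proof (cases u)
      case None
      then show ?thesis using trapped_infinity[OF w'] trapped_mono[of 1] by (simp add: shift_def)
    next
      case (Some r)
      then show ?thesis using N[OF w', of "r + s"] sep[of r] j(2) trapped_mono[of N] by (simp add: shift_def)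
    qed
    then have "trapped (N + 1 + j) (u, Some w)"
      using trapped_later[of "N + 1" j "(u, Some w)"] by (simp only: j(1))
    then show ?thesis
    proof (rule trapped_mono)
      have "real j \<le> Y + 2" using j(5) w by simp
      then show "N + 1 + j \<le> N + 1 + nat \<lceil>Y + 2\<rceil>" by linarith
    qed
  qed
  then show ?thesis by blast
qed

text \<open>At least \<open>R + m + 2\<close> translations are needed, after which
  \<open>\<bar>r + s\<bar> \<ge> m + 2\<close>: coming from above \<open>0 < y \<le> 1 / 2\<close>,
  from below \<open>- 1 / y \<ge> m + 2\<close>, and both lie in \<open>Dom\<close>.\<close>

lemma trapped_far:
  assumes "\<bar>r\<bar> \<le> R" "R + real m + 3 \<le> \<bar>w\<bar>" shows "trapped 0 (Some r, Some w)"
proof -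
  obtain j s w' where j: "(F a b ^^ j) (Some r, Some w) = (shift s (Some r), Some w')" "w' = w + s"
    "\<bar>s\<bar> = real j" "\<bar>w\<bar> - 1 \<le> real j" "real j \<le> \<bar>w\<bar> + 2"
    "\<forall>i<j. \<not> strip ((F a b ^^ i) (Some r, Some w))"
    "s \<le> 0 \<and> b - 1 \<le> w' \<and> w' < b \<or> 0 \<le> s \<and> a \<le> w' \<and> w' < a + 1 \<or> s = 0 \<and> a \<le> w' \<and> w' < b"
    by (rule enter_strip[of "Some r" w])
  have "R + real m + 2 \<le> \<bar>s\<bar>" "0 \<le> R" using j(3,4) assms by linarith+
  then consider "s < 0" "r + s \<le> - (real m + 2)" "b - 1 \<le> w'" "w' < b"
    | "0 < s" "real m + 2 \<le> r + s" "a \<le> w'" "w' < a + 1"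
    using j(7) assms(1) by linarith
  then have "r + s \<noteq> 0 \<and> (w', - 1 / (r + s)) \<in> Dom"
  proof cases
    case 1
    then have "- 1 / (r + s) \<le> 1 / 2" "0 < - 1 / (r + s)"
      by (auto simp: divide_simps)
    then show ?thesis using 1 by (auto intro!: Dom_plus_half)
  next
    case 2
    then have "(w', - 1 / (r + s)) \<in> Dom" by (intro Dom_minus) auto
    then show ?thesis using 2 by simp
  qed
  then have "trapped 0 (pt w' (- 1 / (r + s)))" "r + s \<noteq> 0" using trapped_Dom by auto
  moreover from this have "(F a b ^^ j) (Some r, Some w) = pt w' (- 1 / (r + s))"
    using j(1) by (simp add: shift_def pt_def)
  ultimately show ?thesis using j(6) by (simp add: trapped_first[of j])
qed

text \<open>Near \<open>(x, \<infinity>)\<close> the initial stretch of translations is arbitrarily long, but it ends in \<open>Dom\<close>,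
  before any other point in the strip; so \<open>N = 0\<close> works there.\<close>

lemma trapped_neighbourhood:
  assumes "c \<in> offdiag"
  shows "\<exists>U N. openin plane U \<and> c \<in> U \<and> (\<forall>z\<in>U. trapped N z)"
proof -
  obtain X Y where c: "c = (X, Y)" "X \<noteq> Y" using assms by (auto simp: offdiag_def)
  show ?thesis
  proof (cases Y)
    case None
    then obtain x where x: "X = Some x" using c by (cases X) auto
    let ?M = "\<bar>x\<bar> + 1 + real m + 3"
    let ?U = "Some ` {x - 1<..<x + 1} \<times> insert None (Some ` {r. ?M < \<bar>r\<bar>})"
    have "openin plane ?U"
      by (subst openin_prod_Times_iff) (simp add: openin_rbar_finite openin_rbar_infinite[OF compact_abs_le])
    moreover have "trapped 0 z" if "z \<in> ?U" for z
    proof -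
      from that obtain r W where z: "z = (Some r, W)" "x - 1 < r" "r < x + 1" by auto
      have r: "\<bar>r\<bar> \<le> \<bar>x\<bar> + 1" using z by arith
      show ?thesis
      proof (cases W)
        case None then show ?thesis using z strip_None by (simp add: trapped_def)
      next
        case (Some w)
        then have "\<bar>x\<bar> + 1 + real m + 3 \<le> \<bar>w\<bar>" using z that by auto
        then show ?thesis unfolding z Some by (rule trapped_far[OF r])
      qed
    qed
    ultimately show ?thesis using c None x by (intro exI[of _ ?U] exI[of _ 0]) auto
  next
    case (Some y)
    show ?thesis
    proof (cases X)
      case None
      \<comment> \<open>\<open>\<bar>r\<bar> > \<bar>y\<bar> + 2\<close> and
        \<open>\<bar>w\<bar> < \<bar>y\<bar> + 1\<close> keep \<open>r\<close> and \<open>w\<close>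
        at distance at least 1.\<close>
      let ?M = "\<bar>y\<bar> + 2"
      let ?U = "insert None (Some ` {r. ?M < \<bar>r\<bar>}) \<times> Some ` {y - 1<..<y + 1}"
      obtain N where N: "\<And>u w. \<bar>w\<bar> \<le> \<bar>y\<bar> + 1 \<Longrightarrow> (\<And>r. u = Some r \<Longrightarrow> 1 \<le> \<bar>r - w\<bar>) \<Longrightarrow> trapped N (u, Some w)"
        using trapped_separated_all[of 1 "\<bar>y\<bar> + 1"] by auto
      have "openin plane ?U"
        by (subst openin_prod_Times_iff) (simp add: openin_rbar_finite openin_rbar_infinite[OF compact_abs_le])
      moreover have "trapped N z" if "z \<in> ?U" for z
        using that by (auto intro!: N)
      ultimately show ?thesis using c Some None by (intro exI[of _ ?U] exI[of _ N]) auto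
    next
      case (Some x)
      define d where "d = \<bar>x - y\<bar> / 3"
      have d: "0 < d" "\<bar>x - y\<bar> = 3 * d" using c \<open>Y = Some y\<close> Some by (auto simp: d_def)
      let ?U = "Some ` {x - d<..<x + d} \<times> Some ` {y - d<..<y + d}"
      obtain N where N: "\<And>u w. \<bar>w\<bar> \<le> \<bar>y\<bar> + d \<Longrightarrow> (\<And>r. u = Some r \<Longrightarrow> d \<le> \<bar>r - w\<bar>) \<Longrightarrow> trapped N (u, Some w)"
        using trapped_separated_all[OF d(1), of "\<bar>y\<bar> + d"] by auto
      have "openin plane ?U"
        by (subst openin_prod_Times_iff) (simp add: openin_rbar_finite)
      moreover have "trapped N z" if "z \<in> ?U" for z
        using that d(2) by (auto intro!: N)
      ultimately show ?thesis using c Some \<open>Y = Some y\<close> d by (intro exI[of _ ?U] exI[of _ N]) auto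
    qed
  qed
qed

lemma trapped_compact:
  assumes "compactin plane C" "C \<subseteq> offdiag"
  shows "\<exists>N. \<forall>z\<in>C. trapped N z"
proof -
  define \<U> where "\<U> = {U. openin plane U \<and> (\<exists>N. \<forall>z\<in>U. trapped N z)}"
  have "C \<subseteq> \<Union>\<U>"
  proof
    fix c assume "c \<in> C"
    then obtain U N where "openin plane U" "c \<in> U" "\<forall>z\<in>U. trapped N z"
      using assms(2) trapped_neighbourhood[of c] by auto
    then show "c \<in> \<Union>\<U>" by (auto simp: \<U>_def)
  qed
  moreover have "openin plane U" if "U \<in> \<U>" for U using that by (simp add: \<U>_def)
  ultimately obtain \<F> where \<F>: "finite \<F>" "\<F> \<subseteq> \<U>" "C \<subseteq> \<Union>\<F>"
    using compactinD[OF assms(1), of \<U>] by auto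
  have "\<forall>U\<in>\<F>. \<exists>N. \<forall>z\<in>U. trapped N z" using \<F>(2) by (auto simp: \<U>_def)
  then obtain f where f: "\<And>U z. U \<in> \<F> \<Longrightarrow> z \<in> U \<Longrightarrow> trapped (f U) z" by metis
  have "trapped (\<Sum>U\<in>\<F>. f U) z" if "z \<in> C" for z
  proof -
    obtain U where U: "U \<in> \<F>" "z \<in> U" using \<F>(3) \<open>z \<in> C\<close> by auto
    then have "f U \<le> (\<Sum>U\<in>\<F>. f U)" using \<F>(1) by (intro member_le_sum) auto
    then show ?thesis using f[OF U] trapped_mono by blast
  qed
  then show ?thesis by blast
qed

lemma attractor_subset_Dom:
  assumes "z \<in> attractor a b" "strip z" shows "in_Dom z"
proof -
  obtain C where C: "compactin plane C" "C \<subseteq> offdiag" "\<And>n. z \<in> (\<Union>k\<in>{n..}. (F a b ^^ k) ` C)"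
    using assms(1) by (auto simp: attractor_def)
  obtain N where N: "\<forall>z\<in>C. trapped N z" using trapped_compact[OF C(1,2)] by auto
  obtain k c where "N \<le> k" "c \<in> C" "z = (F a b ^^ k) c" using C(3)[of N] by auto
  then show ?thesis using N assms(2) by (auto simp: trapped_def)
qed

text \<open>In terms of \<open>u = - 1 / y\<close>, the bound \<open>y \<le> m / (m + 1)\<close>
  reads \<open>u \<le> - 1 - 1 / m\<close>, and larger \<open>y\<close> occur only for
  \<open>x \<ge> - 1 / a - 1 \<ge> 0\<close>. Negative \<open>y\<close> gives
  \<open>u \<ge> m\<close>; here \<open>u < 2\<close> is possible only for \<open>m = 1\<close> and
  \<open>x < 1 - 1 / b \<le> 0\<close>. Adding infinity to the closed sets of \<open>u\<close> makes
  them compact.\<close>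

definition core :: "(rbar \<times> rbar) set" where
  "core = insert None (Some ` {1..}) \<times> Some ` {- 1..0}
    \<union> insert None (Some ` {2..}) \<times> Some ` {- 1..1}
    \<union> insert None (Some ` {..- 1}) \<times> Some ` {0..1}
    \<union> insert None (Some ` {..- 1 - 1 / real m}) \<times> Some ` {- 1..1}"

lemma core_compact: "compactin plane core"
proof -
  have "compactin plane (insert None (Some ` A) \<times> Some ` B)" if "closed A" "compact B" for A B
    using compactin_rbar_infinite[OF that(1)] compactin_rbar_finite[OF that(2)] by (simp add: compactin_Times)
  then show ?thesis unfolding core_def by (intro compactin_Un) simp_all
qed

lemma core_offdiag: "core \<subseteq> offdiag"
proof -
  have m0: "0 < 1 / real m" using m_ge by simp
  have core: "\<exists>x. w = Some x \<and> (\<forall>r. u = Some r \<longrightarrow> 1 \<le> r \<and> x \<le> 0 \<or> 2 \<le> r \<and> x \<le> 1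
      \<or> r \<le> - 1 \<and> 0 \<le> x \<or> r \<le> - 1 - 1 / real m \<and> - 1 \<le> x)" if "(u, w) \<in> core" for u w
    using that unfolding core_def by (elim UnE) auto
  have "u \<noteq> w" if uw: "(u, w) \<in> core" for u w
  proof
    assume "u = w"
    then obtain x where "1 \<le> x \<and> x \<le> 0 \<or> 2 \<le> x \<and> x \<le> 1
        \<or> x \<le> - 1 \<and> 0 \<le> x \<or> x \<le> - 1 - 1 / real m \<and> - 1 \<le> x"
      using core[OF uw] by blast
    then show False using m0 by linarith
  qed
  then show ?thesis by (auto simp: offdiag_def)
qed

lemma Dom_core:
  assumes "(x, y) \<in> Dom" shows "pt x y \<in> core"
proof -
  have x1: "- 1 \<le> x" "x \<le> 1" using Dom_bounds[OF assms] a_ge b_le by linarith+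
  consider "y = 0" | "0 < y" "(x, y) \<in> Pplus" | "y < 0" "(x, y) \<in> Pminus"
  proof -
    have "(x, y) \<in> Pplus \<longrightarrow> 0 \<le> y" "(x, y) \<in> Pminus \<longrightarrow> y \<le> 0" "(x, y) \<in> Pplus \<or> (x, y) \<in> Pminus"
      using assms by (auto simp: Dom_def Pplus_def Pminus_def)
    then show thesis using that by linarith
  qed
  then show ?thesis
  proof cases
    case 1
    then show ?thesis using x1 by (simp add: pt_def core_def)
  next
    case 2
    then have y1: "- 1 / y \<le> - 1" by (simp add: Pplus_def)
    show ?thesis
    proof (cases "- 1 / a - 1 \<le> x")
      case True
      then have "0 \<le> x" using inv_a_bounds(1) by linarith
      then show ?thesis using 2 y1 x1 by (simp add: pt_def core_def)
    next
      case False
      then have "y \<le> real m / (real m + 1)" using 2 by (auto simp: Pplus_def)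
      then have "1 / (real m / (real m + 1)) \<le> 1 / y" using 2(1) m_ge by (intro divide_left_mono mult_pos_pos) auto
      then have "- 1 / y \<le> - 1 - 1 / real m" using m_ge by (simp add: add_divide_distrib)
      then show ?thesis using 2(1) x1 by (simp add: pt_def core_def)
    qed
  next
    case 3
    have right: "- 1 / (real m + 1) \<le> y" if "real m - 1 / b \<le> x"
      using 3(2) that by (simp add: Pminus_def)
    have ge: "q \<le> - 1 / y" if "- 1 / q \<le> y" "0 < q" for q
      using that 3(1) by (simp add: field_simps)
    have vm: "real m \<le> - 1 / y" using 3 m_ge by (intro ge) (auto simp: Pminus_def)
    show ?thesis
    proof (cases "2 \<le> - 1 / y")
      case True
      then show ?thesis using 3(1) x1 by (simp add: pt_def core_def)
    next
      case False
      then have m1: "m = 1" using vm m_ge by linarith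
      have "x < 1 - 1 / b"
      proof (rule ccontr)
        assume "\<not> ?thesis"
        then have "- 1 / (real m + 1) \<le> y" using right m1 by simp
        then have "- 1 / 2 \<le> y" by (simp add: m1)
        then show False using ge[of 2] False by simp
      qed
      then have "x \<le> 0" using inv_b_ge by linarith
      moreover have "1 \<le> - 1 / y" using vm m1 by simp
      ultimately show ?thesis using 3(1) x1 by (simp add: pt_def core_def)
    qed
  qed
qed

lemma Dom_predecessor:
  assumes "(x', y') \<in> Dom" "y' \<notin> \<rat>"
  obtains x y j where "(x, y) \<in> Dom" "y \<notin> \<rat>" "1 \<le> j" "(F a b ^^ j) (pt x y) = pt x' y'"
proof -
  have ne: "y' \<noteq> 0" using assms(2) by auto
  have irr: "1 / y' \<notin> \<rat>"
  proof
    assume "1 / y' \<in> \<rat>"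
    then have "1 / (1 / y') \<in> \<rat>" by (rule Rats_divide[OF Rats_1])
    then show False using assms(2) by simp
  qed
  have pt': "pt x' y' = (Some (- 1 / y'), Some x')" using ne by (simp add: pt_def)
  show ?thesis
  proof (cases "0 < y'")
    case True
    obtain x y n where p: "(x, y) \<in> Dom" "neg_step x n x'" "y = real n - 1 / y'"
      using Dom_predecessor_pos[OF assms(1) True assms(2)] by blast
    have y: "y \<notin> \<rat>"
    proof
      assume "y \<in> \<rat>"
      then have "real n - y \<in> \<rat>" by (intro Rats_diff) auto
      then show False using irr p(3) by simp
    qed
    then have "y \<noteq> 0" by auto
    then have "(F a b ^^ Suc n) (pt x y) = pt x' y'"
      unfolding pt_def[of x y] F_neg_step(1)[OF p(2)] pt' by (simp add: shift_def p(3))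
    then show ?thesis using p(1) y by (intro that[of x y "Suc n"]) auto
  next
    case False
    with ne have neg: "y' < 0" by simp
    obtain x y k where p: "(x, y) \<in> Dom" "pos_step x k x'" "y = - 1 / y' - real k"
      using Dom_predecessor_neg[OF assms(1) neg assms(2)] by blast
    have y: "y \<notin> \<rat>"
    proof
      assume "y \<in> \<rat>"
      then have "- (y + real k) \<in> \<rat>" by (intro Rats_add Rats_minus_iff[THEN iffD2]) auto
      then show False using irr p(3) by simp
    qed
    then have "y \<noteq> 0" by auto
    then have "(F a b ^^ Suc k) (pt x y) = pt x' y'"
      unfolding pt_def[of x y] F_pos_step(1)[OF p(2)] pt' by (simp add: shift_def p(3))
    then show ?thesis using p(1) y by (intro that[of x y "Suc k"]) auto
  qed
qed

lemma Dom_subset_attractor: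
  assumes "(x, y) \<in> Dom" "y \<notin> \<rat>" shows "pt x y \<in> attractor a b"
proof -
  have "\<exists>k x0 y0. n \<le> k \<and> (x0, y0) \<in> Dom \<and> y0 \<notin> \<rat> \<and> (F a b ^^ k) (pt x0 y0) = pt x y" for n
  proof (induction n)
    case 0
    then show ?case using assms by (intro exI[of _ 0] exI[of _ x] exI[of _ y]) simp
  next
    case (Suc n)
    then obtain k x0 y0 where k: "n \<le> k" "(x0, y0) \<in> Dom" "y0 \<notin> \<rat>" "(F a b ^^ k) (pt x0 y0) = pt x y"
      by blast
    obtain x1 y1 j where j: "(x1, y1) \<in> Dom" "y1 \<notin> \<rat>" "1 \<le> j" "(F a b ^^ j) (pt x1 y1) = pt x0 y0"
      using Dom_predecessor[OF k(2,3)] .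
    have "(F a b ^^ (k + j)) (pt x1 y1) = pt x y" using k(4) j(4) by (simp add: funpow_add)
    then show ?case using k(1) j by (intro exI[of _ "k + j"]) auto
  qed
  then have "pt x y \<in> (\<Union>k\<in>{n..}. (F a b ^^ k) ` core)" for n
    using Dom_core by (metis UN_I atLeast_iff image_eqI)
  then show ?thesis using core_compact core_offdiag by (auto simp: attractor_def)
qed

lemma Lam_hat_real_iff:
  "(x, y) \<in> Lam_hat_real a b \<longleftrightarrow> a \<le> x \<and> x \<le> b \<and> pt x y \<in> attractor a b"
proof
  assume "(x, y) \<in> Lam_hat_real a b"
  then obtain u r where "(u, Some r) \<in> attractor a b" "a \<le> r" "r \<le> b" "Some x = S (S (Some r))" "Some y = S u"
    by (auto simp: Lam_hat_real_def Lam_hat_def Lam_def simp del: S.simps)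
  then show "a \<le> x \<and> x \<le> b \<and> pt x y \<in> attractor a b"
    by (simp add: S_S pt_def del: S.simps)
next
  assume r: "a \<le> x \<and> x \<le> b \<and> pt x y \<in> attractor a b"
  then have "(S (S (Some y)), S (Some x)) \<in> Lam a b"
    unfolding Lam_def pt_def by (force simp del: S.simps simp: image_iff)
  then have "(S (S (Some x)), S (S (Some y))) \<in> Lam_hat a b"
    unfolding Lam_hat_def by (force simp del: S.simps simp: image_iff)
  then show "(x, y) \<in> Lam_hat_real a b" by (simp add: Lam_hat_real_def S_S del: S.simps)
qed

text \<open>\<open>Lam\<close> is cut out by \<open>w \<le> b\<close> but the strip by
  \<open>w < b\<close>, whence \<open>x \<noteq> b\<close> for one inclusion; irrational
  \<open>y\<close> provides the infinite backward orbit for the other.\<close>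

lemma Lam_hat_real_Dom:
  assumes "x \<noteq> b" "y \<notin> \<rat>" shows "(x, y) \<in> Lam_hat_real a b \<longleftrightarrow> (x, y) \<in> Dom"
proof
  assume "(x, y) \<in> Lam_hat_real a b"
  then have "in_Dom (pt x y)" using assms(1) by (intro attractor_subset_Dom) (auto simp: Lam_hat_real_iff strip_pt)
  then show "(x, y) \<in> Dom" by (auto simp: in_Dom_def pt_inject)
next
  assume "(x, y) \<in> Dom"
  then show "(x, y) \<in> Lam_hat_real a b"
    using Dom_subset_attractor Dom_bounds assms(2) by (fastforce simp: Lam_hat_real_iff)
qed

section \<open>The invariant density\<close>

lemma t_mono: assumes "p \<le> q" "real q \<le> real m - 1" shows "t p \<le> t q"
proof -
  have "0 < 1 / b - real q" using hi a_neg assms(2) by linarith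
  then show ?thesis using assms(1) by (simp add: t_def frac_le)
qed

lemma t_ge: "real p \<le> real m - 1 \<Longrightarrow> b - 1 \<le> t p"
  using t_mono[of 0 p] t_0 by simp

text \<open>\<open>T2S\<close> is parabolic with fixed point -1: in the coordinate
  \<open>1 / (x + 1)\<close> it is subtraction of 1, and \<open>b - 1\<close> has the coordinate
  \<open>1 / b\<close>.\<close>

lemma T2S_iterate: "real p \<le> real m - 1 \<Longrightarrow> (T2S ^^ p) (b - 1) = t p"
proof (induction p)
  case 0
  then show ?case by (simp add: t_0)
next
  case (Suc p)
  define s where "s = 1 / b - real p"
  have s: "1 < s" using hi a_neg Suc.prems by (simp add: s_def)
  have "t p = 1 / s - 1" "t (Suc p) = 1 / (s - 1) - 1" by (simp_all add: t_def s_def algebra_simps)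
  moreover have "1 / s - 1 = (1 - s) / s" using s by (simp add: diff_divide_distrib)
  moreover have "- 1 / ((1 - s) / s) - 2 = 1 / (s - 1) - 1" using s by (simp add: divide_simps) algebra
  ultimately have "T2S (t p) = t (Suc p)" by (simp only: T2S_def)
  then show ?case using Suc by simp
qed

lemma h_plus_t:
  "h_plus a b m x =
     (\<Sum>p = 1..m - 1. if t (p - 1) \<le> x \<and> x < t p then 1 / (x + (real p + 1) / real p) else 0)
     + (if t (m - 1) \<le> x \<and> x < - 1 / a - 1 then 1 / (x + (real m + 1) / real m) else 0)
     + (if - 1 / a - 1 \<le> x \<and> x < b then 1 / (x + 1) else 0)"
proof -
  have "(T2S ^^ (m - 1)) (b - 1) = t (m - 1)" using m_ge by (intro T2S_iterate) auto
  moreover have "(T2S ^^ (p - 1)) (b - 1) = t (p - 1)" "(T2S ^^ p) (b - 1) = t p" if "p \<in> {1..m - 1}" for p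
    using that by (auto intro!: T2S_iterate)
  then have "(\<Sum>p = 1..m - 1. if (T2S ^^ (p - 1)) (b - 1) \<le> x \<and> x < (T2S ^^ p) (b - 1)
        then 1 / (x + (real p + 1) / real p) else 0)
    = (\<Sum>p = 1..m - 1. if t (p - 1) \<le> x \<and> x < t p then 1 / (x + (real p + 1) / real p) else 0)"
    by (intro sum.cong) simp_all
  ultimately show ?thesis unfolding h_plus_def by simp
qed

text \<open>\<open>c\<close> is the height of the slice and \<open>c / (1 + x * c)\<close> its
  integral. Leaving out \<open>y = 0\<close> lets \<open>c = 0\<close> stand for an empty
  slice.\<close>

lemma h_plus_slice:
  assumes "a \<le> x" "x < b"
  shows "\<exists>c\<ge>0. (\<forall>y. y \<noteq> 0 \<longrightarrow> ((x, y) \<in> Pplus \<longleftrightarrow> 0 \<le> y \<and> y \<le> c)) \<and> 0 < 1 + x * c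
    \<and> h_plus a b m x = c / (1 + x * c)"
proof -
  have t_last: "t p \<le> - 1 / a - 1" if "p < m" for p using that by (intro t_le_last) auto
  have t_low: "b - 1 \<le> t p" if "p < m" for p using that by (intro t_ge) auto
  have tm: "t p \<le> t q" if "p \<le> q" "q < m" for p q using that by (intro t_mono) auto
  have a0: "0 \<le> - 1 / a - 1" using inv_a_bounds(1) by linarith
  have pos: "0 < 1 + x * (q / (q + 1))" if "b - 1 \<le> x" "0 < q" for q :: real
  proof -
    have "(- 1) * (q / (q + 1)) \<le> x * (q / (q + 1))" using that b_pos by (intro mult_right_mono) auto
    moreover have "q / (q + 1) < 1" using that by simp
    ultimately show ?thesis by linarith
  qed
  consider (none) "x < b - 1" | (right) "- 1 / a - 1 \<le> x" | (mid) "t (m - 1) \<le> x" "x < - 1 / a - 1"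
    | (left) "b - 1 \<le> x" "x < t (m - 1)" by linarith
  then show ?thesis
  proof cases
    case none
    have "\<not> t p \<le> x" if "p < m" for p using t_low[OF that] none by linarith
    then have "h_plus a b m x = 0"
      using none a0 m_ge b_le unfolding h_plus_t by (auto intro!: sum.neutral)
    then show ?thesis using none by (intro exI[of _ 0]) (auto simp: Pplus_def)
  next
    case right
    have ge: "\<not> x < t p" if "p < m" for p using t_last[OF that] right by linarith
    then have "(\<Sum>p = 1..m - 1. if t (p - 1) \<le> x \<and> x < t p then 1 / (x + (real p + 1) / real p) else 0) = 0"
      by (intro sum.neutral) auto
    then have "h_plus a b m x = 1 / (1 + x * 1)"
      using right assms unfolding h_plus_t by (simp add: add.commute)
    moreover have "(x, y) \<in> Pplus \<longleftrightarrow> 0 \<le> y \<and> y \<le> 1" for y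
      using ge right assms a0 b_le by (auto simp: Pplus_def)
    ultimately show ?thesis using right a0 by (intro exI[of _ 1]) auto
  next
    case mid
    have ge: "\<not> x < t p" if "p < m" for p using tm[of p "m - 1"] that mid by force
    then have "(\<Sum>p = 1..m - 1. if t (p - 1) \<le> x \<and> x < t p then 1 / (x + (real p + 1) / real p) else 0) = 0"
      by (intro sum.neutral) auto
    then have h: "h_plus a b m x = 1 / (x + (real m + 1) / real m)" using mid unfolding h_plus_t by simp
    have x1: "b - 1 \<le> x" using t_low[of "m - 1"] mid m_ge by simp
    have m1: "real m / (real m + 1) \<le> 1" by simp
    have "(x, y) \<in> Pplus \<longleftrightarrow> 0 \<le> y \<and> y \<le> real m / (real m + 1)" for y
      using ge mid x1 assms m1 order_trans[OF _ m1, of y] by (auto simp: Pplus_def)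
    then show ?thesis using h pos[OF x1, of "real m"] m_ge frac_inverse[of "real m" x]
      by (intro exI[of _ "real m / (real m + 1)"]) auto
  next
    case left
    \<comment> \<open>Since \<open>p / (p + 1)\<close> increases with \<open>p\<close>, the least
      \<open>p\<close> with \<open>x < t p\<close> carries the strictest of the applicable
      bounds.\<close>
    define p where "p = (LEAST p. x < t p)"
    have xp: "x < t p" unfolding p_def by (rule LeastI[of "\<lambda>p. x < t p", OF left(2)])
    have pm: "p \<le> m - 1" unfolding p_def by (rule Least_le[of "\<lambda>p. x < t p", OF left(2)])
    have "p \<noteq> 0"
    proof
      assume "p = 0"
      then show False using xp left(1) by (simp add: t_0)
    qed
    then have p1: "1 \<le> p" "p \<le> m - 1" "p < m" using pm by auto
    have least: "t q \<le> x" if "q < p" for q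
      using not_less_Least[of q "\<lambda>p. x < t p"] that unfolding p_def by auto
    have "(\<Sum>q = 1..m - 1. if t (q - 1) \<le> x \<and> x < t q then 1 / (x + (real q + 1) / real q) else 0)
      = (\<Sum>q = 1..m - 1. if q = p then 1 / (x + (real p + 1) / real p) else 0)"
    proof (rule sum.cong[OF refl])
      fix q assume q: "q \<in> {1..m - 1}"
      consider "q < p" | "q = p" | "p < q" by linarith
      then show "(if t (q - 1) \<le> x \<and> x < t q then 1 / (x + (real q + 1) / real q) else 0)
        = (if q = p then 1 / (x + (real p + 1) / real p) else 0)"
      proof cases
        case 1 then show ?thesis using least[of q] by auto
      next
        case 2 then show ?thesis using least[of "p - 1"] xp p1 by auto
      next
        case 3
        then have "t p \<le> t (q - 1)" using q by (intro tm) auto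
        then show ?thesis using xp 3 by auto
      qed
    qed
    also have "\<dots> = 1 / (x + (real p + 1) / real p)" using p1 by simp
    finally have h: "h_plus a b m x = 1 / (x + (real p + 1) / real p)"
      using left t_last[of "m - 1"] m_ge unfolding h_plus_t by auto
    have le: "real p / (real p + 1) \<le> real q / (real q + 1)" if "p \<le> q" for q
      using that by (simp add: field_simps)
    have "y \<le> real q / (real q + 1)" if "y \<le> real p / (real p + 1)" "x < t q" for q y
    proof -
      have "p \<le> q" using least[of q] that(2) by (meson not_le)
      then show ?thesis using le that(1) order_trans by blast
    qed
    moreover have "y \<le> real m / (real m + 1)" "y \<le> 1" if "y \<le> real p / (real p + 1)" for y
    proof -
      show "y \<le> real m / (real m + 1)" using order_trans[OF that le] p1 by simp
      then show "y \<le> 1" by (rule order_trans) simp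
    qed
    ultimately have "(x, y) \<in> Pplus \<longleftrightarrow> 0 \<le> y \<and> y \<le> real p / (real p + 1)" for y
      using left(1) assms xp p1 by (auto simp: Pplus_def)
    then show ?thesis using h pos[OF left(1), of "real p"] p1 frac_inverse[of "real p" x]
      by (intro exI[of _ "real p / (real p + 1)"]) auto
  qed
qed

lemma h_minus_slice:
  assumes "a \<le> x"
  shows "\<exists>c\<ge>0. (\<forall>y. y \<noteq> 0 \<longrightarrow> ((x, y) \<in> Pminus \<longleftrightarrow> - c \<le> y \<and> y \<le> 0)) \<and> 0 < 1 + x * - c
    \<and> h_minus a b m x = c / (1 + x * - c)"
proof -
  have inv: "1 / (q - x) = (1 / q) / (1 + x * - (1 / q))" "0 < 1 + x * - (1 / q)" if "x < q" "0 < q" for q :: real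
    using that by (auto simp: field_simps)
  have B: "- 1 / b + real m < real m" using b_pos by simp
  have m0: "0 < real m" "1 / (real m + 1) \<le> 1 / real m" using m_ge by (auto simp: field_simps)
  consider "x < - 1 / b + real m" | "- 1 / b + real m \<le> x" "x < a + 1" | "a + 1 \<le> x" "\<not> x < - 1 / b + real m"
    by linarith
  then show ?thesis
  proof cases
    case 1
    then have "x < a + 1" "x < real m" using hi B by linarith+
    then show ?thesis using 1 inv[of "real m"] m0 assms
      by (intro exI[of _ "1 / real m"]) (auto simp: Pminus_def h_minus_def)
  next
    case 2
    have "x < real m + 1" using 2 a_neg by linarith
    then show ?thesis using 2 inv[of "real m + 1"] m0 assms
      by (intro exI[of _ "1 / (real m + 1)"]) (auto simp: Pminus_def h_minus_def)
  next
    case 3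
    then show ?thesis by (intro exI[of _ 0]) (auto simp: Pminus_def h_minus_def)
  qed
qed

lemma nn_integral_Dom_slice:
  assumes "0 \<le> c"
  shows "(\<integral>\<^sup>+y. indicator Dom (x, y) * ennreal (c / (1 + x * y)\<^sup>2) \<partial>lborel)
    = ennreal (c * h a b m x) * indicator {a..<b} x"
proof (cases "a \<le> x \<and> x < b")
  case False
  then have "(x, y) \<notin> Dom" for y using Dom_bounds[of x y] by auto
  then show ?thesis using False by auto
next
  case True
  then obtain u v where u: "0 \<le> u" "\<And>y. y \<noteq> 0 \<Longrightarrow> (x, y) \<in> Pplus \<longleftrightarrow> 0 \<le> y \<and> y \<le> u" "0 < 1 + x * u"
      "h_plus a b m x = u / (1 + x * u)"
    and v: "0 \<le> v" "\<And>y. y \<noteq> 0 \<Longrightarrow> (x, y) \<in> Pminus \<longleftrightarrow> - v \<le> y \<and> y \<le> 0" "0 < 1 + x * - v"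
      "h_minus a b m x = v / (1 + x * - v)"
    using h_plus_slice[of x] h_minus_slice[of x] by blast
  have "(\<integral>\<^sup>+y. indicator Dom (x, y) * ennreal (c / (1 + x * y)\<^sup>2) \<partial>lborel)
    = (\<integral>\<^sup>+y. ennreal (c / (1 + x * y)\<^sup>2) * indicator {- v..u} y \<partial>lborel)"
  proof (rule nn_integral_cong_AE)
    have "indicator Dom (x, y) * ennreal (c / (1 + x * y)\<^sup>2) = ennreal (c / (1 + x * y)\<^sup>2) * indicator {- v..u} y"
      if "y \<noteq> 0" for y
    proof -
      have "(x, y) \<in> Dom \<longleftrightarrow> y \<in> {- v..u}" using u(1,2) v(1,2) that by (auto simp: Dom_def)
      then show ?thesis by (simp add: indicator_def)
    qed
    then show "AE y in lborel. indicator Dom (x, y) * ennreal (c / (1 + x * y)\<^sup>2)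
      = ennreal (c / (1 + x * y)\<^sup>2) * indicator {- v..u} y"
      using AE_lborel_singleton[of 0] by auto
  qed
  also have "\<dots> = ennreal (c * (u / (1 + x * u) - (- v) / (1 + x * (- v))))"
    using u v assms by (intro nn_integral_slice) auto
  also have "\<dots> = ennreal (c * h a b m x)" using u(4) v(4) by (simp add: h_def)
  finally show ?thesis using True by simp
qed

lemma Dom_measurable: "Dom \<in> sets (borel \<Otimes>\<^sub>M borel)"
proof -
  have "Measurable.pred (borel \<Otimes>\<^sub>M borel) (\<lambda>z :: real \<times> real. b - 1 \<le> fst z \<and> fst z < b
     \<and> 0 \<le> snd z \<and> snd z \<le> 1
     \<and> (\<forall>p\<in>{1..<m}. fst z < t p \<longrightarrow> snd z \<le> real p / (real p + 1))
     \<and> (fst z < - 1 / a - 1 \<longrightarrow> snd z \<le> real m / (real m + 1)))"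
    by measurable
  moreover have "Measurable.pred (borel \<Otimes>\<^sub>M borel) (\<lambda>z :: real \<times> real. a \<le> fst z \<and> fst z < a + 1
     \<and> - 1 / real m \<le> snd z \<and> snd z \<le> 0
     \<and> (real m - 1 / b \<le> fst z \<longrightarrow> - 1 / (real m + 1) \<le> snd z))"
    by measurable
  ultimately have "Pplus \<in> sets (borel \<Otimes>\<^sub>M borel)" "Pminus \<in> sets (borel \<Otimes>\<^sub>M borel)"
    by (simp_all add: Pplus_def Pminus_def pred_def case_prod_beta' space_pair_measure)
  then show ?thesis unfolding Dom_def by (rule sets.Un)
qed

definition exceptional :: "(real \<times> real) set" where
  "exceptional = {b} \<times> UNIV \<union> UNIV \<times> \<rat>"

lemma exceptional_null: "exceptional \<in> null_sets lborel"
proof -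
  have Q: "(\<rat> :: real set) \<in> null_sets lborel"
    by (intro countable_imp_null_set_lborel countable_rat)
  have sp: "emeasure (lborel \<Otimes>\<^sub>M lborel) (A \<times> B) = emeasure lborel A * emeasure lborel B"
    if "A \<in> sets borel" "B \<in> sets borel" for A B :: "real set"
    using that by (intro lborel.emeasure_pair_measure_Times) auto
  have "{b} \<times> (UNIV :: real set) \<in> null_sets (lborel \<Otimes>\<^sub>M lborel)"
    by (rule null_setsI, subst sp) (auto intro!: pair_measureI)
  moreover have "(UNIV :: real set) \<times> (\<rat> :: real set) \<in> null_sets (lborel \<Otimes>\<^sub>M lborel)"
    using Q by (intro null_setsI, subst sp) (auto intro!: pair_measureI)
  ultimately show ?thesis unfolding exceptional_def lborel_prod by (rule null_sets.Un)
qed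

lemma Lam_hat_real_AE: "AE z in lebesgue. z \<in> Lam_hat_real a b \<longleftrightarrow> z \<in> Dom"
proof -
  have "AE z in lborel. z \<notin> exceptional" using exceptional_null by (rule AE_not_in)
  then have "AE z in lebesgue. z \<notin> exceptional" by (rule AE_completion)
  then show ?thesis
    by (rule AE_mp) (auto simp: exceptional_def Lam_hat_real_Dom intro!: AE_I2)
qed

text \<open>Off a null set it coincides with the Borel set \<open>Dom\<close>, and completeness of
  Lebesgue measure takes care of the part inside the null set.\<close>

lemma Lam_hat_real_measurable: "Lam_hat_real a b \<in> sets lebesgue"
proof -
  have e: "exceptional \<in> sets lebesgue"
    using exceptional_null by (intro sets_completionI_sets) (rule null_setsD2)
  have "Lam_hat_real a b = (Dom - exceptional) \<union> (Lam_hat_real a b \<inter> exceptional)"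
    using Lam_hat_real_Dom by (auto simp: exceptional_def)
  moreover have "Lam_hat_real a b \<inter> exceptional \<in> sets lebesgue"
    using exceptional_null by (rule null_sets_completion) simp
  moreover have "Dom \<in> sets lebesgue"
    using Dom_measurable unfolding borel_prod by (intro sets_completionI_sets) simp
  then have "Dom - exceptional \<in> sets lebesgue" using e by (rule sets.Diff)
  ultimately show ?thesis by (metis sets.Un)
qed

text \<open>\<open>c = 1\<close> with \<open>B = UNIV\<close> yields \<open>K\<close>;
  \<open>c = 1 / K a b\<close> with arbitrary \<open>B\<close> yields \<open>mu\<close>.\<close>

lemma nn_integral_Lam_hat_real:
  assumes "0 \<le> c" "B \<in> sets borel"
  shows "(\<integral>\<^sup>+z. indicator (Lam_hat_real a b) z * ennreal (c / (1 + fst z * snd z)\<^sup>2) * indicator B (fst z) \<partial>lebesgue)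
    = (\<integral>\<^sup>+x. ennreal (c * h a b m x) * indicator {a..<b} x * indicator B x \<partial>lborel)"
proof -
  let ?g = "\<lambda>z :: real \<times> real. indicator Dom z * ennreal (c / (1 + fst z * snd z)\<^sup>2) * indicator B (fst z)"
  have "(\<integral>\<^sup>+z. indicator (Lam_hat_real a b) z * ennreal (c / (1 + fst z * snd z)\<^sup>2) * indicator B (fst z) \<partial>lebesgue)
    = (\<integral>\<^sup>+z. ?g z \<partial>lebesgue)"
    using Lam_hat_real_AE by (intro nn_integral_cong_AE) (auto simp: indicator_def elim!: eventually_mono)
  also have "\<dots> = (\<integral>\<^sup>+z. ?g z \<partial>(lborel \<Otimes>\<^sub>M lborel))"
    by (simp add: nn_integral_completion lborel_prod)
  also have "\<dots> = (\<integral>\<^sup>+x. \<integral>\<^sup>+y. ?g (x, y) \<partial>lborel \<partial>lborel)"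
  proof (rule lborel.nn_integral_fst[symmetric])
    note Dom_measurable[measurable]
    have [measurable]: "B \<in> sets borel" by fact
    show "?g \<in> borel_measurable (lborel \<Otimes>\<^sub>M lborel)"
      by measurable
  qed
  also have "\<dots> = (\<integral>\<^sup>+x. ennreal (c * h a b m x) * indicator {a..<b} x * indicator B x \<partial>lborel)"
  proof (rule nn_integral_cong)
    fix x :: real
    have "(\<integral>\<^sup>+y. ?g (x, y) \<partial>lborel)
      = (if x \<in> B then \<integral>\<^sup>+y. indicator Dom (x, y) * ennreal (c / (1 + x * y)\<^sup>2) \<partial>lborel else 0)"
      by (auto simp: indicator_def)
    then show "(\<integral>\<^sup>+y. ?g (x, y) \<partial>lborel) = ennreal (c * h a b m x) * indicator {a..<b} x * indicator B x"
      by (simp add: nn_integral_Dom_slice[OF assms(1)])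
  qed
  finally show ?thesis .
qed

lemma h_outside: assumes "\<not> (a \<le> x \<and> x < b)" shows "h a b m x = 0"
proof -
  have out: "\<not> (l \<le> x \<and> x < r)" if "a \<le> l" "r \<le> b" for l r using assms that by linarith
  have le: "a \<le> t p" "t p \<le> b" if "p < m" for p
  proof -
    have "real p \<le> real m - 1" using that by auto
    then have "b - 1 \<le> t p" "t p \<le> - 1 / a - 1" by (rule t_ge, rule t_le_last)
    then show "a \<le> t p" "t p \<le> b" using a_succ_lt inv_a_bounds(2) by linarith+
  qed
  have a0: "a \<le> - 1 / a - 1" "- 1 / a - 1 \<le> b" using inv_a_bounds a_neg by linarith+
  have s0: "(\<Sum>p = 1..m - 1. if t (p - 1) \<le> x \<and> x < t p then 1 / (x + (real p + 1) / real p) else 0) = 0"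
  proof (rule sum.neutral, rule ballI)
    fix p assume "p \<in> {1..m - 1}"
    then have "\<not> (t (p - 1) \<le> x \<and> x < t p)" by (intro out le) auto
    then show "(if t (p - 1) \<le> x \<and> x < t p then 1 / (x + (real p + 1) / real p) else 0) = 0"
      by (rule if_not_P)
  qed
  have s1: "\<not> (t (m - 1) \<le> x \<and> x < - 1 / a - 1)" using m_ge a0 by (intro out le) auto
  have s2: "\<not> (- 1 / a - 1 \<le> x \<and> x < b)" using a0 by (intro out) auto
  have "h_plus a b m x = 0" unfolding h_plus_t s0 if_not_P[OF s1] if_not_P[OF s2] by simp
  moreover have s3: "\<not> (a \<le> x \<and> x < - 1 / b + real m)" "\<not> (- 1 / b + real m \<le> x \<and> x < a + 1)"
    using hi lo a_succ_lt by (intro out; simp)+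
  have "h_minus a b m x = 0" unfolding h_minus_def if_not_P[OF s3(1)] if_not_P[OF s3(2)] ..
  ultimately show ?thesis by (simp add: h_def)
qed

section \<open>The total mass\<close>

text \<open>With \<open>s = 1 / b - p\<close>, the numerator is
  \<open>1 / s + 1 / p = (1 / b) / (s * p)\<close> and the denominator
  \<open>(1 / b + 1) / ((s + 1) * p)\<close>. Each ratio is thus
  \<open>1 / (1 + b) * ((s + 1) / s)\<close>, and the second factor telescopes.\<close>

lemma sum_ln_t_ratio:
  assumes "real k \<le> real m - 1"
  shows "(\<Sum>p = 1..k. ln ((t p + (real p + 1) / real p) / (t (p - 1) + (real p + 1) / real p)))
    = ln ((1 / (1 + b)) ^ k * (1 / b / (1 / b - real k)))"
  and "\<And>p. p \<in> {1..k} \<Longrightarrow> 1 \<le> (t p + (real p + 1) / real p) / (t (p - 1) + (real p + 1) / real p)"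
proof -
  have c: "(real p + 1) / real p = 1 + 1 / real p" if "1 \<le> p" for p using that by (simp add: add_divide_distrib)
  have pos: "0 < t (p - 1) + (real p + 1) / real p" if "1 \<le> p" "p \<le> k" for p
  proof -
    have "b - 1 \<le> t (p - 1)" using that assms by (intro t_ge) auto
    moreover have "0 < 1 / real p" using that by simp
    ultimately show ?thesis unfolding c[OF that(1)] using b_pos by linarith
  qed
  show "1 \<le> (t p + (real p + 1) / real p) / (t (p - 1) + (real p + 1) / real p)" if "p \<in> {1..k}" for p
  proof -
    have "t (p - 1) \<le> t p" using that assms by (intro t_mono) auto
    then show ?thesis using pos[of p] that by simp
  qed
  show "(\<Sum>p = 1..k. ln ((t p + (real p + 1) / real p) / (t (p - 1) + (real p + 1) / real p)))
    = ln ((1 / (1 + b)) ^ k * (1 / b / (1 / b - real k)))"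
    using assms
  proof (induction k)
    case 0
    then show ?case using b_pos by simp
  next
    case (Suc k)
    define s where "s = 1 / b - real (Suc k)"
    define q where "q = real (Suc k)"
    have s: "0 < s" using hi a_neg Suc.prems unfolding s_def by linarith
    have q: "0 < q" by (simp add: q_def)
    have sq: "1 / b = s + q" by (simp add: s_def q_def)
    have t: "t (Suc k) = 1 / s - 1" "t k = 1 / (s + 1) - 1" by (simp_all add: t_def s_def)
    have num: "1 / s - 1 + (q + 1) / q = (s + q) / (s * q)" "1 / (s + 1) - 1 + (q + 1) / q = (s + q + 1) / ((s + 1) * q)"
      using s q by (auto simp: field_simps)
    have b1: "1 / (1 + b) = (s + q) / (s + q + 1)"
    proof -
      have "(s + q) * b = 1" using sq[symmetric] b_pos by simp
      then show ?thesis using b_pos s q by (simp add: field_simps)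
    qed
    have "(\<Sum>p = 1..Suc k. ln ((t p + (real p + 1) / real p) / (t (p - 1) + (real p + 1) / real p)))
      = ln ((1 / (1 + b)) ^ k * (1 / b / (1 / b - real k)))
        + ln ((1 / s - 1 + (q + 1) / q) / (1 / (s + 1) - 1 + (q + 1) / q))"
      using Suc by (simp add: t q_def)
    also have "(1 / s - 1 + (q + 1) / q) / (1 / (s + 1) - 1 + (q + 1) / q) = 1 / (1 + b) * ((s + 1) / s)"
      unfolding num b1 using s q by (simp add: divide_simps)
    also have "1 / b - real k = s + 1" by (simp add: s_def)
    also have "ln ((1 / (1 + b)) ^ k * (1 / b / (s + 1))) + ln (1 / (1 + b) * ((s + 1) / s))
      = ln ((1 / (1 + b)) ^ k * (1 / b / (s + 1)) * (1 / (1 + b) * ((s + 1) / s)))"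
      using s b_pos by (subst ln_mult) auto
    also have "(1 / (1 + b)) ^ k * (1 / b / (s + 1)) * (1 / (1 + b) * ((s + 1) / s)) = (1 / (1 + b)) ^ Suc k * (1 / b / s)"
      using s by simp
    finally show ?case by (simp only: s_def)
  qed
qed

lemma nn_integral_h:
  "(\<integral>\<^sup>+x. ennreal (h a b m x) * indicator {a..<b} x \<partial>lborel)
    = ennreal (ln ((real m - a) * (1 + b) powi (2 - int m)))"
  and ln_h_nonneg: "0 \<le> ln ((real m - a) * (1 + b) powi (2 - int m))"
proof -
  let ?P = "\<lambda>p x. if t (p - 1) \<le> x \<and> x < t p then 1 / (x + (real p + 1) / real p) else 0"
  let ?M = "\<lambda>x. if t (m - 1) \<le> x \<and> x < - 1 / a - 1 then 1 / (x + (real m + 1) / real m) else 0"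
  let ?R = "\<lambda>x. if - 1 / a - 1 \<le> x \<and> x < b then 1 / (x + 1) else 0"
  let ?L = "\<lambda>x. if a \<le> x \<and> x < real m - 1 / b then 1 / (real m - x) else 0"
  let ?L' = "\<lambda>x. if real m - 1 / b \<le> x \<and> x < a + 1 then 1 / (real m + 1 - x) else 0"
  \<comment> \<open>\<open>W = 1 / b - (m - 1)\<close> is the coordinate of the last breakpoint,
    \<open>t (m - 1) = 1 / W - 1\<close>; it is positive as \<open>W \<ge> - a\<close>.\<close>
  define W where "W = 1 / b - real m + 1"
  have W: "0 < W" "W - 1 = 1 / b - real m" using hi a_neg by (auto simp: W_def)
  have m0: "0 < real m" "real (m - 1) = real m - 1" using m_ge by auto
  have cp: "(real p + 1) / real p = 1 + 1 / real p" if "1 \<le> p" for p using that by (simp add: add_divide_distrib)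
  have tp: "0 < t q + (real p + 1) / real p" if "q < m" "1 \<le> p" for p q
  proof -
    have "b - 1 \<le> t q" using that by (intro t_ge) auto
    moreover have "0 < 1 / real p" using that by simp
    ultimately show ?thesis unfolding cp[OF that(2)] using b_pos by linarith
  qed
  have P: "(\<integral>\<^sup>+x. ennreal (?P p x) \<partial>lborel)
      = ennreal (ln ((t p + (real p + 1) / real p) / (t (p - 1) + (real p + 1) / real p)))" if "p \<in> {1..m - 1}" for p
    using that by (intro nn_integral_ln_plus t_mono tp) auto
  have M: "(\<integral>\<^sup>+x. ennreal (?M x) \<partial>lborel)
      = ennreal (ln ((- 1 / a - 1 + (real m + 1) / real m) / (t (m - 1) + (real m + 1) / real m)))"
    using m_ge by (intro nn_integral_ln_plus t_le_last tp) auto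
  have R: "(\<integral>\<^sup>+x. ennreal (?R x) \<partial>lborel) = ennreal (ln ((b + 1) / (- 1 / a - 1 + 1)))"
    using inv_a_bounds by (intro nn_integral_ln_plus) linarith+
  have L: "(\<integral>\<^sup>+x. ennreal (?L x) \<partial>lborel) = ennreal (ln ((real m - a) / (real m - (real m - 1 / b))))"
    using lo b_pos by (intro nn_integral_ln_minus) auto
  have L': "(\<integral>\<^sup>+x. ennreal (?L' x) \<partial>lborel)
      = ennreal (ln ((real m + 1 - (real m - 1 / b)) / (real m + 1 - (a + 1))))"
    using hi a_neg m0 by (intro nn_integral_ln_minus) auto
  have P0: "0 \<le> ?P p x" if "p \<in> {1..m - 1}" for p x
  proof -
    have "0 < t (p - 1) + (real p + 1) / real p" using that by (intro tp) auto
    then show ?thesis by auto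
  qed
  have M0: "0 \<le> ?M x" for x using tp[of "m - 1" m] m_ge by auto
  have R0: "0 \<le> ?R x" for x using inv_a_bounds by auto
  have L0: "0 \<le> ?L x" for x using b_pos by (auto intro: less_imp_le[OF order_less_trans])
  have L'0: "0 \<le> ?L' x" for x using a_neg m0 by auto
  have hsum: "h a b m x = (\<Sum>p = 1..m - 1. ?P p x) + ?M x + ?R x + ?L x + ?L' x" for x
    unfolding h_def h_plus_t h_minus_def by auto
  have "(\<integral>\<^sup>+x. ennreal (h a b m x) * indicator {a..<b} x \<partial>lborel) = (\<integral>\<^sup>+x. ennreal (h a b m x) \<partial>lborel)"
    using h_outside by (intro nn_integral_cong) (auto simp: indicator_def)
  also have "\<dots> = (\<integral>\<^sup>+x. (\<Sum>p = 1..m - 1. ennreal (?P p x)) + ennreal (?M x) + ennreal (?R x)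
      + ennreal (?L x) + ennreal (?L' x) \<partial>lborel)"
  proof (rule nn_integral_cong)
    fix x
    have "0 \<le> (\<Sum>p = 1..m - 1. ?P p x)" using P0 by (intro sum_nonneg) auto
    moreover have "(\<Sum>p = 1..m - 1. ennreal (?P p x)) = ennreal (\<Sum>p = 1..m - 1. ?P p x)"
      using P0 by (intro sum_ennreal) auto
    ultimately show "ennreal (h a b m x) = (\<Sum>p = 1..m - 1. ennreal (?P p x)) + ennreal (?M x) + ennreal (?R x)
      + ennreal (?L x) + ennreal (?L' x)"
      unfolding hsum using M0[of x] R0[of x] L0[of x] L'0[of x]
      by (simp only: ennreal_plus[symmetric] add_nonneg_nonneg)
  qed
  also have "\<dots> = (\<Sum>p = 1..m - 1. \<integral>\<^sup>+x. ennreal (?P p x) \<partial>lborel) + (\<integral>\<^sup>+x. ennreal (?M x) \<partial>lborel)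
      + (\<integral>\<^sup>+x. ennreal (?R x) \<partial>lborel) + (\<integral>\<^sup>+x. ennreal (?L x) \<partial>lborel) + (\<integral>\<^sup>+x. ennreal (?L' x) \<partial>lborel)"
    by (simp add: nn_integral_add nn_integral_sum)
  also have "(\<Sum>p = 1..m - 1. \<integral>\<^sup>+x. ennreal (?P p x) \<partial>lborel)
      = (\<Sum>p = 1..m - 1. ennreal (ln ((t p + (real p + 1) / real p) / (t (p - 1) + (real p + 1) / real p))))"
    by (intro sum.cong refl P)
  also have "\<dots> = ennreal (\<Sum>p = 1..m - 1. ln ((t p + (real p + 1) / real p) / (t (p - 1) + (real p + 1) / real p)))"
    using sum_ln_t_ratio(2)[of "m - 1"] m0 by (intro sum_ennreal ln_ge_zero) auto
  also have "(\<Sum>p = 1..m - 1. ln ((t p + (real p + 1) / real p) / (t (p - 1) + (real p + 1) / real p)))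
      = ln ((1 / (1 + b)) ^ (m - 1) * (1 / b / W))"
    using m0 by (subst sum_ln_t_ratio(1)) (auto simp: W_def algebra_simps)
  finally have total: "(\<integral>\<^sup>+x. ennreal (h a b m x) * indicator {a..<b} x \<partial>lborel)
    = ennreal (ln ((1 / (1 + b)) ^ (m - 1) * (1 / b / W)))
      + ennreal (ln ((- 1 / a - 1 + (real m + 1) / real m) / (t (m - 1) + (real m + 1) / real m)))
      + ennreal (ln ((b + 1) / (- 1 / a - 1 + 1)))
      + ennreal (ln ((real m - a) / (real m - (real m - 1 / b))))
      + ennreal (ln ((real m + 1 - (real m - 1 / b)) / (real m + 1 - (a + 1))))"
    unfolding M R L L' .
  define A where "A = real m - a"
  have A: "0 < A" using m0 a_neg by (simp add: A_def)
  have mW: "1 / b + 1 = W + real m" by (simp add: W_def)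
  have e2: "(- 1 / a - 1 + (real m + 1) / real m) / (t (m - 1) + (real m + 1) / real m)
      = A * W / ((- a) * (1 / b + 1))"
  proof -
    have "- 1 / a - 1 + (real m + 1) / real m = A / ((- a) * real m)"
      using a_neg m0 by (simp add: A_def field_simps)
    moreover have "t (m - 1) + (real m + 1) / real m = (1 / b + 1) / (W * real m)"
    proof -
      have "t (m - 1) = 1 / W - 1" unfolding t_def m0(2) by (simp add: W_def algebra_simps)
      moreover have "1 / W - 1 + (q + 1) / q = (W + q) / (W * q)" if "0 < q" for q
        using W that by (simp add: field_simps)
      ultimately show ?thesis unfolding mW using m0(1) by simp
    qed
    moreover have "A / (n * M) / (c / (W * M)) = A * W / (n * c)" if "0 < M" for n M c :: real
      using that by simp
    ultimately show ?thesis using m0(1) by metis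
  qed
  have e3: "(b + 1) / (- 1 / a - 1 + 1) = (b + 1) * (- a)" using a_neg by (simp add: field_simps)
  have e4: "(real m - a) / (real m - (real m - 1 / b)) = A * b" using b_pos by (simp add: A_def)
  have e5: "(real m + 1 - (real m - 1 / b)) / (real m + 1 - (a + 1)) = (1 / b + 1) / A" by (simp add: A_def)
  \<comment> \<open>The five logarithms are shown to be nonnegative one by one, since only then is
    the sum of their \<open>ennreal\<close> values the \<open>ennreal\<close> of their sum.\<close>
  have n1: "0 \<le> ln ((1 / (1 + b)) ^ (m - 1) * (1 / b / W))"
  proof -
    have "0 \<le> (\<Sum>p = 1..m - 1. ln ((t p + (real p + 1) / real p) / (t (p - 1) + (real p + 1) / real p)))"
      using sum_ln_t_ratio(2)[of "m - 1"] m0 by (intro sum_nonneg ln_ge_zero) auto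
    also have "\<dots> = ln ((1 / (1 + b)) ^ (m - 1) * (1 / b / W))"
      using m0 by (subst sum_ln_t_ratio(1)) (auto simp: W_def algebra_simps)
    finally show ?thesis .
  qed
  have n2: "0 \<le> ln (A * W / ((- a) * (1 / b + 1)))"
    unfolding e2[symmetric] using tp[of "m - 1" m] t_le_last[of "m - 1"] m_ge by (intro ln_ratio_nonneg) auto
  have n3: "0 \<le> ln ((b + 1) * (- a))"
    unfolding e3[symmetric] using inv_a_bounds by (intro ln_ratio_nonneg) linarith+
  have n4: "0 \<le> ln (A * b)"
    unfolding e4[symmetric] using lo b_pos by (intro ln_ratio_nonneg) auto
  have n5: "0 \<le> ln ((1 / b + 1) / A)"
    using A hi b_pos by (intro ln_ratio_nonneg) (auto simp: A_def)
  have int: "(\<integral>\<^sup>+x. ennreal (h a b m x) * indicator {a..<b} x \<partial>lborel)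
    = ennreal (ln ((1 / (1 + b)) ^ (m - 1) * (1 / b / W)) + ln (A * W / ((- a) * (1 / b + 1)))
      + ln ((b + 1) * (- a)) + ln (A * b) + ln ((1 / b + 1) / A))"
    unfolding total e2 e3 e4 e5 using n1 n2 n3 n4 n5 by (simp only: ennreal_plus[symmetric] add_nonneg_nonneg)
  have "ln ((1 / (1 + b)) ^ (m - 1) * (1 / b / W)) + ln (A * W / ((- a) * (1 / b + 1)))
      + ln ((b + 1) * (- a)) + ln (A * b) + ln ((1 / b + 1) / A)
    = ln ((1 / (1 + b)) ^ (m - 1) * (1 / b / W) * (A * W / ((- a) * (1 / b + 1))) * ((b + 1) * (- a)) * (A * b) * ((1 / b + 1) / A))"
  proof -
    have "0 < - a" "0 < b + 1" "0 < 1 / b + 1" "0 < 1 / b / W" "0 < 1 / (1 + b)"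
      using a_neg b_pos W by (auto simp: add_pos_pos)
    with A W(1) b_pos have "0 < (1 / (1 + b)) ^ (m - 1) * (1 / b / W)" "0 < A * W / ((- a) * (1 / b + 1))"
      "0 < (b + 1) * (- a)" "0 < A * b" "0 < (1 / b + 1) / A"
      by - (intro divide_pos_pos[of "_ * _" "_ * _"] divide_pos_pos[of "_ + _" A] mult_pos_pos zero_less_power; assumption)+
    then show ?thesis by (simp only: ln_mult_pos mult_pos_pos)
  qed
  also have "(1 / (1 + b)) ^ (m - 1) * (1 / b / W) * (A * W / ((- a) * (1 / b + 1))) * ((b + 1) * (- a)) * (A * b) * ((1 / b + 1) / A)
    = A * ((1 / (1 + b)) ^ (m - 1) * (1 + b))"
  proof -
    define c where "c = 1 / b + 1"
    define g where "g = (1 / (1 + b)) ^ (m - 1)"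
    have "c \<noteq> 0" using inv_b_ge unfolding c_def by linarith
    then show ?thesis unfolding c_def[symmetric] g_def[symmetric] using A W b_pos a_neg by (simp add: divide_simps)
  qed
  also have "(1 / (1 + b)) ^ (m - 1) * (1 + b) = (1 + b) powi (2 - int m)"
  proof -
    have "(1 + b) powi (2 - int m) = (1 + b) powi (1 - int (m - 1))" using m_ge by (simp add: of_nat_diff)
    also have "\<dots> = (1 + b) powi 1 / (1 + b) powi (int (m - 1))" using b_pos by (intro power_int_diff) auto
    finally show ?thesis by (simp add: power_one_over)
  qed
  finally have val: "ln ((1 / (1 + b)) ^ (m - 1) * (1 / b / W)) + ln (A * W / ((- a) * (1 / b + 1)))
      + ln ((b + 1) * (- a)) + ln (A * b) + ln ((1 / b + 1) / A) = ln (A * (1 + b) powi (2 - int m))" .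
  show "(\<integral>\<^sup>+x. ennreal (h a b m x) * indicator {a..<b} x \<partial>lborel)
    = ennreal (ln ((real m - a) * (1 + b) powi (2 - int m)))"
    using int unfolding val by (simp only: A_def)
  show "0 \<le> ln ((real m - a) * (1 + b) powi (2 - int m))"
    using n1 n2 n3 n4 n5 val unfolding A_def by linarith
qed

lemma K_eq: "K a b = ln ((real m - a) * (1 + b) powi (2 - int m))"
proof -
  have meas: "(\<lambda>(x, y). ennreal (1 / (1 + x * y)\<^sup>2)) \<in> borel_measurable lebesgue"
  proof -
    have "(\<lambda>z :: real \<times> real. ennreal (1 / (1 + fst z * snd z)\<^sup>2)) \<in> borel_measurable (borel \<Otimes>\<^sub>M borel)"
      by measurable
    then show ?thesis unfolding case_prod_beta' borel_prod by (intro measurable_completion) simp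
  qed
  have "emeasure nu (Lam_hat_real a b)
    = (\<integral>\<^sup>+z. indicator (Lam_hat_real a b) z * ennreal (1 / (1 + fst z * snd z)\<^sup>2) * indicator UNIV (fst z) \<partial>lebesgue)"
    unfolding nu_def using Lam_hat_real_measurable
    by (subst emeasure_density[OF meas]) (auto intro!: nn_integral_cong simp: case_prod_beta' mult.commute)
  also have "\<dots> = ennreal (ln ((real m - a) * (1 + b) powi (2 - int m)))"
    by (subst nn_integral_Lam_hat_real) (auto simp: nn_integral_h)
  finally show ?thesis using ln_h_nonneg by (simp add: K_def measure_def)
qed

lemma mu_eq:
  "mu a b = density lborel (\<lambda>x. ennreal (1 / K a b * h a b m x) * indicator {a..<b} x)"
proof (rule measure_eqI)
  show "sets (mu a b) = sets (density lborel (\<lambda>x. ennreal (1 / K a b * h a b m x) * indicator {a..<b} x))"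
    by (simp add: mu_def)
  fix B assume "B \<in> sets (mu a b)"
  then have B: "B \<in> sets borel" by (simp add: mu_def)
  have K0: "0 \<le> 1 / K a b" by (simp add: K_def)
  note Lam_hat_real_measurable[measurable]
  have meas: "(\<lambda>(x, y). indicator (Lam_hat_real a b) (x, y) * ennreal (1 / (K a b * (1 + x * y)\<^sup>2)))
      \<in> borel_measurable lebesgue"
  proof -
    have "(\<lambda>z :: real \<times> real. ennreal (1 / (K a b * (1 + fst z * snd z)\<^sup>2))) \<in> borel_measurable (borel \<Otimes>\<^sub>M borel)"
      by measurable
    then have "(\<lambda>z :: real \<times> real. ennreal (1 / (K a b * (1 + fst z * snd z)\<^sup>2))) \<in> borel_measurable lebesgue"
      unfolding borel_prod by (intro measurable_completion) simp
    then show ?thesis unfolding case_prod_beta' prod.collapse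
      by (intro borel_measurable_times_ennreal borel_measurable_indicator Lam_hat_real_measurable)
  qed
  have "(fst :: real \<times> real \<Rightarrow> real) \<in> measurable (borel \<Otimes>\<^sub>M borel) borel" by measurable
  then have fst_leb: "(fst :: real \<times> real \<Rightarrow> real) \<in> measurable lebesgue borel"
    unfolding borel_prod by (intro measurable_completion) simp
  then have fst_meas: "fst \<in> measurable (nu_ab a b) borel" by (simp add: nu_ab_def)
  have pre: "fst -` B \<in> sets (lebesgue :: (real \<times> real) measure)"
    using measurable_sets[OF fst_leb B] by simp
  have meas_h: "(\<lambda>x. ennreal (1 / K a b * h a b m x) * indicator {a..<b} x) \<in> borel_measurable lborel"
    unfolding h_def h_plus_def h_minus_def by measurable
  have "emeasure (mu a b) B = emeasure (nu_ab a b) (fst -` B)"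
    unfolding mu_def using emeasure_distr[OF fst_meas B] by (simp add: nu_ab_def)
  also have "\<dots> = (\<integral>\<^sup>+z. indicator (Lam_hat_real a b) z * ennreal ((1 / K a b) / (1 + fst z * snd z)\<^sup>2) * indicator B (fst z) \<partial>lebesgue)"
    unfolding nu_ab_def emeasure_density[OF meas pre]
    by (intro nn_integral_cong) (auto simp: case_prod_beta' indicator_def)
  also have "\<dots> = (\<integral>\<^sup>+x. ennreal (1 / K a b * h a b m x) * indicator {a..<b} x * indicator B x \<partial>lborel)"
    by (rule nn_integral_Lam_hat_real[OF K0 B])
  also have "\<dots> = emeasure (density lborel (\<lambda>x. ennreal (1 / K a b * h a b m x) * indicator {a..<b} x)) B"
    using B by (subst emeasure_density[OF meas_h]) auto
  finally show "emeasure (mu a b) B = \<dots>" .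
qed

end

theorem theorem7p1:
  fixes a b :: real and m :: nat
  assumes "(a, b) \<in> param_set"
    and "- 1 \<le> a" and "a < 0" and "0 < b" and "b \<le> 1" and "a \<le> - b"
    and "1 \<le> m"
    and "1 \<le> - 1 / a" and "- 1 / a \<le> b + 1"
    and "a \<le> - 1 / b + real m" and "- 1 / b + real m \<le> a + 1"
  shows "K a b = ln ((real m - a) * (1 + b) powi (2 - int m))
    \<and> mu a b = density lborel (\<lambda>x. ennreal (1 / K a b * h a b m x) * indicator {a..<b} x)"
proof -
  interpret gauss_params a b m
  proof
    show "a * (b + 1) \<le> - 1" using assms(3,9) by (simp add: field_simps)
  qed (use assms in simp_all)
  show ?thesis using K_eq mu_eq by blast
qed

end
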